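(* (Dispersive coupling.) Let $g,\omega_a,\omega_b\in\mathbb{R}$ with $g\neq0$, let $H_I=\frac g2\sigma_3\otimes\sigma_3$, and consider the controlled two-qubit master equation $\dot\rho=-i[H(u(t)),\rho]+\mathcal{L}(\rho)$ of the context. (1) Let $\epsilon>0$, let $u:[0,\epsilon]\to\mathbb{R}^3$ be a piecewise-$C^\infty$ control, and let $\rho(t)$ be a corresponding solution with $\rho(0)\in\mathcal{P}$ such that $\mathrm{Tr}\big((\mathrm{Tr}_A\rho(t))^2\big)=1$ for all $t\in[0,\epsilon]$. Then at least one of the following holds: (a) $(v^B_3(t))^2=\frac14$ and $v^B_1(t)=v^B_2(t)=0$ for all $t\in[0,\epsilon]$; in this case $\rho_B(t)=\mathrm{Tr}_A\rho(t)$ is constant, equal to $\frac12(I_2+\sigma_3)$ or to $\frac12(I_2-\sigma_3)$; (b) $(v^A_3(t))^2=\frac14$ and $v^A_1(t)=v^A_2(t)=0$ for all $t\in[0,\epsilon]$; in this case $\frac{(\mathbf{v}_0)_3}{2}+v^A_3\,\hat d_{33}=0$, and $v^B$ satisfies the equation (which does not involve the control) $$\dot v_1^B=-(\omega_b+2g v_3^A)\,v_2^B,\qquad \dot v_2^B=(\omega_b+2g v_3^A)\,v_1^B,\qquad \dot v_3^B=0 .$$ (2) For every control and every dissipation $\mathcal{L}$ of the form given in the context, each of the two sets $\{\rho_A\otimes\frac12(I_2+\sigma_3)\}$ and $\{\rho_A\otimes\frac12(I_2-\sigma_3)\}$, where $\rho_A$ ranges over all density matrices on $\mathbb{C}^2$,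 is invariant under the (forward in time) evolution of the master equation.
   Context: $\mathcal{P}$ is the set of density matrices (Hermitian, positive semidefinite, trace one) on $\mathbb{C}^2\otimes\mathbb{C}^2$ (first factor $A$, second factor $B$); $\mathrm{Tr}_A$, $\mathrm{Tr}_B$ are the partial traces over the first and second factor; $\sigma_1,\sigma_2,\sigma_3$ are the Pauli matrices. Hamiltonian: $H(u)=\frac12\big(\omega_a\sigma_3+\sum_{j=1}^3u_j\sigma_j\big)\otimes I_2+H_I+I_2\otimes\frac{\omega_b}{2}\sigma_3$. Dissipation: $\mathcal{L}(\rho)=\sum_k\big(L_k\rho L_k^\dagger-\frac12L_k^\dagger L_k\rho-\frac12\rho L_k^\dagger L_k\big)$, a finite sum with $L_k=\ell_k\otimes I_2$, each $\ell_k$ a traceless complex $2\times2$ matrix. For a state $\rho$, set $v^A_i=\frac12\mathrm{Tr}\big(\rho(\sigma_i\otimes I_2)\big)$ and $v^B_j=\frac12\mathrm{Tr}\big(\rho(I_2\otimes\sigma_j)\big)$, so that $\mathrm{Tr}_B\rho=\frac12I_2+\sum_iv^A_i\sigma_i$ and $\mathrm{Tr}_A\rho=\frac12I_2+\sum_jv^B_j\sigma_j$. With $\mathcal{L}_A(X)=\sum_k\big(\ell_kX\ell_k^\dagger-\frac12\ell_k^\dagger\ell_kX-\frac12X\ell_k^\dagger\ell_k\big)$ on $2\times2$ matrices, set $\hat d_{ij}=\frac12\mathrm{Tr}\big(\sigma_i\mathcal{L}_A(\sigma_j)\big)$ and $(\mathbf{v}_0)_i=\frac12\mathrm{Tr}\big(\sigma_i\mathcal{L}_A(I_2)\big)$,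 $i,j=1,2,3$. *)

theory Defs
  imports "HOL-Analysis.Analysis"
begin

text \<open>
  The standard basis of \<open>\<complex>\<^sup>2 \<otimes> \<complex>\<^sup>2\<close> is indexed by the pairs \<open>(i, k) :: 2 \<times> 2\<close>, with \<open>i\<close> belonging
  to the first factor A and \<open>k\<close> to the second factor B.
\<close>

type_synonym cmat2 = "complex ^ 2 ^ 2"
type_synonym cmat4 = "complex ^ (2 \<times> 2) ^ (2 \<times> 2)"

definition dagger :: "complex ^ 'n ^ 'm \<Rightarrow> complex ^ 'm ^ 'n"
  where "dagger M = transpose (map_matrix cnj M)"

definition cscale :: "complex \<Rightarrow> complex ^ 'n ^ 'm \<Rightarrow> complex ^ 'n ^ 'm"
  where "cscale c M = map_matrix (\<lambda>z. c * z) M"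

definition kron :: "complex ^ 'a ^ 'a \<Rightarrow> complex ^ 'b ^ 'b \<Rightarrow> complex ^ ('a \<times> 'b) ^ ('a \<times> 'b)"
    (infixl \<open>\<otimes>\<^sub>K\<close> 80)
  where "M \<otimes>\<^sub>K N = (\<chi> p q. M $ fst p $ fst q * N $ snd p $ snd q)"

definition ptrace_A :: "complex ^ ('a::finite \<times> 'b::finite) ^ ('a \<times> 'b) \<Rightarrow> complex ^ 'b ^ 'b"
  where "ptrace_A M = (\<chi> k l. \<Sum>i\<in>UNIV. M $ (i, k) $ (i, l))"

text \<open>
  The quadratic form of a Hermitian matrix is real, so taking its real part loses nothing.
\<close>

definition density_matrix :: "complex ^ 'n ^ 'n \<Rightarrow> bool"
  where "density_matrix M \<longleftrightarrow>
    dagger M = M \<and>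
    (\<forall>x. 0 \<le> Re (\<Sum>i\<in>UNIV. cnj (x $ i) * (M *v x) $ i)) \<and>
    trace M = 1"

definition pauli :: "3 \<Rightarrow> cmat2"
  where "pauli j =
    (if j = 1 then vector [vector [0, 1], vector [1, 0]]
     else if j = 2 then vector [vector [0, - \<i>], vector [\<i>, 0]]
     else vector [vector [1, 0], vector [0, - 1]])"

definition hamiltonian :: "real \<Rightarrow> real \<Rightarrow> cmat4 \<Rightarrow> real ^ 3 \<Rightarrow> cmat4"
  where "hamiltonian \<omega>\<^sub>a \<omega>\<^sub>b H\<^sub>I u =
    ((1/2) *\<^sub>R (\<omega>\<^sub>a *\<^sub>R pauli 3 + (\<Sum>j\<in>UNIV. u $ j *\<^sub>R pauli j))) \<otimes>\<^sub>K mat 1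
    + H\<^sub>I
    + mat 1 \<otimes>\<^sub>K ((\<omega>\<^sub>b / 2) *\<^sub>R pauli 3)"

definition lindblad :: "nat \<Rightarrow> (nat \<Rightarrow> complex ^ 'n ^ 'n) \<Rightarrow> complex ^ 'n ^ 'n \<Rightarrow> complex ^ 'n ^ 'n"
  where "lindblad K L X =
    (\<Sum>k<K. L k ** X ** dagger (L k)
       - (1/2) *\<^sub>R (dagger (L k) ** L k ** X)
       - (1/2) *\<^sub>R (X ** dagger (L k) ** L k))"

definition master_rhs :: "cmat4 \<Rightarrow> nat \<Rightarrow> (nat \<Rightarrow> cmat2) \<Rightarrow> cmat4 \<Rightarrow> cmat4"
  where "master_rhs H K \<l> \<rho> =
    cscale (- \<i>) (H ** \<rho> - \<rho> ** H) + lindblad K (\<lambda>k. \<l> k \<otimes>\<^sub>K mat 1) \<rho>"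

text \<open>
  Smoothness on a closed interval, with one-sided derivatives at the end points; \<open>D n\<close> is the
  \<open>n\<close>-th derivative.
\<close>

definition smooth_on_Icc :: "(real \<Rightarrow> 'a::real_normed_vector) \<Rightarrow> real \<Rightarrow> real \<Rightarrow> bool"
  where "smooth_on_Icc f a b \<longleftrightarrow>
    (\<exists>D :: nat \<Rightarrow> real \<Rightarrow> 'a.
       (\<forall>t\<in>{a..b}. D 0 t = f t) \<and>
       (\<forall>n. \<forall>t\<in>{a..b}. (D n has_vector_derivative D (Suc n) t) (at t within {a..b})))"

text \<open>
  Each piece extends smoothly to its closed interval; the values at the break points are arbitrary.
\<close>

definition piecewise_smooth :: "real \<Rightarrow> (real \<Rightarrow> 'a::real_normed_vector) \<Rightarrow> bool"
  where "piecewise_smooth T u \<longleftrightarrow>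
    (\<exists>(n::nat) (p :: nat \<Rightarrow> real). p 0 = 0 \<and> p n = T \<and>
       (\<forall>i<n. p i < p (Suc i) \<and>
          (\<exists>w. smooth_on_Icc w (p i) (p (Suc i)) \<and> (\<forall>t\<in>{p i<..<p (Suc i)}. u t = w t))))"

text \<open>
  For a discontinuous control the equation can only be required off the finitely many jumps;
  together with continuity of \<open>\<rho>\<close> this still determines \<open>\<rho>\<close> from \<open>\<rho> 0\<close>.
\<close>

definition master_solution ::
    "real \<Rightarrow> (real ^ 3 \<Rightarrow> cmat4) \<Rightarrow> nat \<Rightarrow> (nat \<Rightarrow> cmat2) \<Rightarrow> (real \<Rightarrow> real ^ 3) \<Rightarrow> (real \<Rightarrow> cmat4) \<Rightarrow> bool"
  where "master_solution T H K \<l> u \<rho> \<longleftrightarrow>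
    continuous_on {0..T} \<rho> \<and>
    (\<exists>S. finite S \<and>
       (\<forall>t\<in>{0..T} - S.
          (\<rho> has_vector_derivative master_rhs (H (u t)) K \<l> (\<rho> t)) (at t within {0..T})))"

text \<open>
  The next four quantities are real for Hermitian \<open>\<rho>\<close>; they are kept as the complex traces that
  define them.
\<close>

definition v_A :: "cmat4 \<Rightarrow> complex ^ 3"
  where "v_A \<rho> = (\<chi> i. (1/2) * trace (\<rho> ** (pauli i \<otimes>\<^sub>K mat 1)))"

definition v_B :: "cmat4 \<Rightarrow> complex ^ 3"
  where "v_B \<rho> = (\<chi> j. (1/2) * trace (\<rho> ** (mat 1 \<otimes>\<^sub>K pauli j)))"

definition d_hat :: "nat \<Rightarrow> (nat \<Rightarrow> cmat2) \<Rightarrow> complex ^ 3 ^ 3"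
  where "d_hat K \<l> = (\<chi> i j. (1/2) * trace (pauli i ** lindblad K \<l> (pauli j)))"

definition v_0 :: "nat \<Rightarrow> (nat \<Rightarrow> cmat2) \<Rightarrow> complex ^ 3"
  where "v_0 K \<l> = (\<chi> i. (1/2) * trace (pauli i ** lindblad K \<l> (mat 1)))"

end

theory Submission
  imports Defs
begin

text \<open>
  With respect to the second factor the Hamiltonian is block diagonal, so the \<open>2 \<times> 2\<close> blocks \<open>R\<^sub>k\<^sub>l\<close> of
  \<open>\<rho>\<close> evolve independently: \<open>R\<^sub>k\<^sub>l' = - i (H\<^sub>k R\<^sub>k\<^sub>l - R\<^sub>k\<^sub>l H\<^sub>l) + L\<^sub>A R\<^sub>k\<^sub>l\<close>, where
  \<open>H\<^sub>1 - H\<^sub>2 = D = g \<sigma>\<^sub>3 + \<omega>\<^sub>b\<close>. Hence the diagonal of \<open>B = Tr\<^sub>A \<rho>\<close> is constant. A state with pure \<open>B\<close> is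
  a product, \<open>R\<^sub>k\<^sub>l = B\<^sub>k\<^sub>l A\<close>; if both diagonal entries of \<open>B\<close> are nonzero, comparing the evolutions of
  \<open>R\<^sub>1\<^sub>1\<close> and \<open>R\<^sub>1\<^sub>2\<close> gives \<open>Tr (D A) A = A D\<close>, which forces \<open>A\<close> to be a pole of the Bloch ball.

  That the evolution preserves positivity is proved by a first-hitting-time argument; applied to
  \<open>\<plusminus> i (\<rho> - \<rho>\<^sup>\<dagger>)\<close> it also yields Hermiticity, and no uniqueness theorem for the equation is needed.
\<close>

section \<open>Complex matrices\<close>

text \<open>Conjugate-linear in the first argument; the real inner product of
  \<open>complex ^ 'n\<close> as a Euclidean space is only its real part.\<close>

definition cinner :: "complex ^ 'n \<Rightarrow> complex ^ 'n \<Rightarrow> complex"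
  where "cinner x y = (\<Sum>i\<in>UNIV. cnj (x $ i) * y $ i)"

text \<open>Taking the real part keeps the form real and real-linear in \<open>M\<close> even before
  \<open>M\<close> is known to be Hermitian.\<close>

definition qform :: "complex ^ 'n ^ 'n \<Rightarrow> complex ^ 'n \<Rightarrow> real"
  where "qform M x = Re (cinner x (M *v x))"

definition psd :: "complex ^ 'n ^ 'n \<Rightarrow> bool"
  where "psd M \<longleftrightarrow> dagger M = M \<and> (\<forall>x. 0 \<le> qform M x)"

lemma density_matrix_iff: "density_matrix M \<longleftrightarrow> psd M \<and> trace M = 1"
  by (simp add: density_matrix_def psd_def qform_def cinner_def)

lemma dagger_nth [simp]: "dagger M $ i $ j = cnj (M $ j $ i)"
  by (simp add: dagger_def transpose_def map_matrix_def)

lemma cscale_nth [simp]: "cscale c M $ i $ j = c * M $ i $ j"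
  by (simp add: cscale_def map_matrix_def)

lemma kron_nth [simp]: "(M \<otimes>\<^sub>K N) $ (i, k) $ (j, l) = M $ i $ j * N $ k $ l"
  by (simp add: kron_def)

lemma dagger_dagger [simp]: "dagger (dagger M) = M"
  by (simp add: vec_eq_iff)

lemma dagger_add: "dagger (M + N) = dagger M + dagger N"
  and dagger_diff: "dagger (M - N) = dagger M - dagger N"
  and dagger_scaleR: "dagger (r *\<^sub>R M) = r *\<^sub>R dagger M"
  and dagger_cscale: "dagger (cscale c M) = cscale (cnj c) (dagger M)"
  and dagger_mat_1: "dagger (mat 1 :: complex ^ 'n ^ 'n) = mat 1"
  by (simp_all add: vec_eq_iff mat_def)

lemma dagger_sum: "dagger (\<Sum>k\<in>I. f k) = (\<Sum>k\<in>I. dagger (f k))"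
  by (simp add: vec_eq_iff)

lemma dagger_mult: "dagger (M ** N) = dagger N ** dagger M"
  by (simp add: vec_eq_iff matrix_matrix_mult_def mult.commute)

lemma dagger_kron: "dagger (M \<otimes>\<^sub>K N) = dagger M \<otimes>\<^sub>K dagger N"
  by (simp add: vec_eq_iff kron_def)

lemma cscale_mult_left: "cscale c M ** N = cscale c (M ** N)"
  and cscale_mult_right: "M ** cscale c N = cscale c (M ** N)"
  by (simp_all add: vec_eq_iff matrix_matrix_mult_def sum_distrib_left mult_ac)

lemma linear_cscale: "linear (cscale c)"
  by (rule linearI) (simp_all add: vec_eq_iff algebra_simps)

lemma linear_matmul_left: "linear (\<lambda>X :: complex ^ 'n ^ 'm. M ** X)"
  by (rule linearI) (simp_all add: vec_eq_iff matrix_matrix_mult_def algebra_simps sum.distrib scaleR_sum_right)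

lemma linear_matmul_right: "linear (\<lambda>X :: complex ^ 'n ^ 'm. X ** M)"
  by (rule linearI) (simp_all add: vec_eq_iff matrix_matrix_mult_def algebra_simps sum.distrib scaleR_sum_right)

lemma linear_dagger: "linear dagger"
  by (rule linearI) (simp_all add: dagger_add dagger_scaleR)

lemma linear_lindblad: "linear (lindblad K L)"
proof -
  have "linear (\<lambda>X. L k ** X ** dagger (L k) - (1/2) *\<^sub>R (dagger (L k) ** L k ** X)
      - (1/2) *\<^sub>R (X ** dagger (L k) ** L k))" for k
    by (intro linear_compose_sub linear_compose_scale_right linear_matmul_left
        linear_compose[OF linear_matmul_left linear_matmul_right, unfolded o_def]
        linear_compose[OF linear_matmul_right linear_matmul_right, unfolded o_def])
  then show ?thesis
    unfolding lindblad_def[abs_def] by (intro linear_compose_sum) auto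
qed

lemma linear_commutator: "linear (\<lambda>X :: complex ^ 'n ^ 'n. cscale c (H ** X - X ** H))"
  by (intro linear_compose[OF _ linear_cscale, unfolded o_def] linear_compose_sub
      linear_matmul_left linear_matmul_right)

text \<open>\<open>linear\<close> covers real scalars only; complex ones are needed, for instance,
  to pull entries of the reduced state of B out of the dissipator.\<close>

lemma lindblad_cscale: "lindblad K L (cscale c X) = cscale c (lindblad K L X)"
proof -
  have "cscale c (r *\<^sub>R M) = r *\<^sub>R cscale c M" for r and M :: "complex ^ 'a ^ 'a"
    by (simp add: linear_cscale linear_scale)
  then show ?thesis
    unfolding lindblad_def linear_sum[OF linear_cscale] linear_diff[OF linear_cscale]
    by (simp add: cscale_mult_left cscale_mult_right)
qed

text \<open>Taking adjoints exchanges the two halves of the anticommutator and preserves the shape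
  of the sandwich term.\<close>

lemma lindblad_dagger: "lindblad K L (dagger X) = dagger (lindblad K L X)"
  unfolding lindblad_def dagger_sum dagger_diff dagger_scaleR dagger_mult dagger_dagger
  by (simp add: matrix_mul_assoc algebra_simps)

lemma trace_sum: "trace (\<Sum>k\<in>I. f k) = (\<Sum>k\<in>I. trace (f k))" for f :: "'i \<Rightarrow> complex ^ 'n ^ 'n"
  unfolding trace_def by (simp add: sum.swap[of _ I])

lemma trace_scaleR: "trace (r *\<^sub>R M) = r *\<^sub>R trace M" for M :: "complex ^ 'n ^ 'n"
  by (simp add: trace_def scaleR_sum_right)

lemma trace_cscale: "trace (cscale c M) = c * trace M"
  by (simp add: trace_def sum_distrib_left)

text \<open>By cyclicity all three terms have the trace of \<open>dagger (L k) ** L k ** X\<close>,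
  with weights \<open>1\<close>, \<open>- 1/2\<close> and \<open>- 1/2\<close>.\<close>

lemma trace_lindblad: "trace (lindblad K L X) = 0"
proof -
  have "trace (L k ** X ** dagger (L k)) = trace (dagger (L k) ** L k ** X)" for k
    by (metis trace_mul_sym matrix_mul_assoc)
  moreover have "trace (X ** dagger (L k) ** L k) = trace (dagger (L k) ** L k ** X)" for k
    by (metis trace_mul_sym matrix_mul_assoc)
  ultimately show ?thesis
    by (simp add: lindblad_def trace_sum trace_sub trace_scaleR flip: scaleR_left.add)
qed

section \<open>The Hermitian inner product and quadratic forms\<close>

lemma cinner_add_right: "cinner x (y + z) = cinner x y + cinner x z"
  and cinner_diff_left: "cinner (x - y) z = cinner x z - cinner y z"
  and cinner_diff_right: "cinner x (y - z) = cinner x y - cinner x z"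
  by (simp_all add: cinner_def algebra_simps sum.distrib sum_subtractf)

lemma cinner_scaleR_left: "cinner (r *\<^sub>R x) y = r *\<^sub>R cinner x y"
  and cinner_scaleR_right: "cinner x (r *\<^sub>R y) = r *\<^sub>R cinner x y"
  by (simp_all add: cinner_def scaleR_sum_right)

lemma cinner_commute: "cinner y x = cnj (cinner x y)"
  by (simp add: cinner_def mult.commute)

lemma cinner_matvec: "cinner x (M *v y) = cinner (dagger M *v x) y"
proof -
  have "cinner x (M *v y) = (\<Sum>i\<in>UNIV. \<Sum>j\<in>UNIV. cnj (x $ i) * (M $ i $ j * y $ j))"
    by (simp add: cinner_def matrix_vector_mult_def sum_distrib_left)
  also have "\<dots> = (\<Sum>j\<in>UNIV. \<Sum>i\<in>UNIV. cnj (x $ i) * (M $ i $ j * y $ j))"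
    by (rule sum.swap)
  also have "\<dots> = cinner (dagger M *v x) y"
    by (simp add: cinner_def matrix_vector_mult_def sum_distrib_left sum_distrib_right mult_ac)
  finally show ?thesis .
qed

lemma norm_cinner_le: "cmod (cinner x y) \<le> norm x * norm y"
proof -
  have "cmod (cinner x y) \<le> (\<Sum>i\<in>UNIV. cmod (x $ i) * cmod (y $ i))"
    unfolding cinner_def by (rule order_trans[OF norm_sum]) (simp add: norm_mult)
  also have "\<dots> \<le> norm x * norm y"
    using L2_set_mult_ineq[of "\<lambda>i. cmod (x $ i)" "\<lambda>i. cmod (y $ i)" UNIV] by (simp add: norm_vec_def)
  finally show ?thesis .
qed

lemma cinner_self: "cinner x x = of_real ((norm x)\<^sup>2)"
  unfolding norm_vec_def L2_set_def cinner_def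
  by (simp add: sum_nonneg complex_norm_square mult.commute del: of_real_power)

lemma linear_matvec_matrix: "linear (\<lambda>M :: complex ^ 'n ^ 'm. M *v x)"
  by (rule linearI)
    (simp_all add: vec_eq_iff matrix_vector_mult_def algebra_simps sum.distrib scaleR_sum_right)

lemma linear_qform: "linear (\<lambda>M :: complex ^ 'n ^ 'n. qform M x)"
  unfolding qform_def
  by (rule linearI)
    (simp_all add: linear_add[OF linear_matvec_matrix] linear_scale[OF linear_matvec_matrix]
       cinner_add_right cinner_scaleR_right)

lemma linear_matvec: "linear (\<lambda>x :: complex ^ 'n. M *v x)"
  by (rule linearI)
    (simp_all add: vec_eq_iff matrix_vector_mult_def algebra_simps sum.distrib scaleR_sum_right)

lemma qform_mat_1: "qform (mat 1) x = (norm x)\<^sup>2"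
  by (simp add: qform_def cinner_self del: of_real_power)

lemma qform_scaleR: "qform M (r *\<^sub>R y) = r\<^sup>2 * qform M y"
  by (simp add: qform_def linear_scale[OF linear_matvec] cinner_scaleR_left cinner_scaleR_right
      power2_eq_square)

text \<open>A zero of a nonnegative form is a minimum, so the form is stationary there: if
  \<open>M *v x\<close> were nonzero, a small step from \<open>x\<close> against it would make the
  form negative.\<close>

lemma psd_qform_eq_0:
  assumes "psd M" and "qform M x = 0"
  shows "M *v x = 0"
proof (rule ccontr)
  define y where "y = M *v x"
  assume "M *v x \<noteq> 0"
  then have y: "(norm y)\<^sup>2 > 0" by (simp add: y_def)
  have expand: "qform M (x - s *\<^sub>R y) = s\<^sup>2 * qform M y - 2 * s * (norm y)\<^sup>2" for s :: real
  proof -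
    have M: "M *v (x - s *\<^sub>R y) = y - s *\<^sub>R (M *v y)"
      by (simp add: linear_diff[OF linear_matvec] linear_scale[OF linear_matvec] y_def)
    moreover have "cinner x (M *v y) = cinner y y"
      using assms(1) by (simp add: cinner_matvec psd_def y_def)
    moreover have "Re (cinner x y) = 0"
      using assms(2) by (simp add: qform_def y_def)
    ultimately show ?thesis
      unfolding qform_def M
      by (simp add: cinner_diff_left cinner_diff_right cinner_scaleR_left
          cinner_scaleR_right cinner_self power2_eq_square algebra_simps del: of_real_power)
  qed
  define q where "q = qform M y"
  have q: "q \<ge> 0" using assms(1) by (simp add: psd_def q_def)
  \<comment> \<open>Any \<open>s > 0\<close> with \<open>s * q < 2 * (norm y)\<^sup>2\<close> makes
    \<open>expand\<close> negative; the summand 1 keeps the quotient meaningful when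
    \<open>q = 0\<close>.\<close>
  define s where "s = (norm y)\<^sup>2 / (q + 1)"
  have s: "s > 0" using y q by (simp add: s_def)
  have "s * q < 2 * (norm y)\<^sup>2"
  proof -
    have "s * q \<le> s * (q + 1)" using s by simp
    also have "\<dots> = (norm y)\<^sup>2" using q by (simp add: s_def)
    finally show ?thesis using y by linarith
  qed
  then have "s * (s * q) < s * (2 * (norm y)\<^sup>2)" using s by simp
  then have "qform M (x - s *\<^sub>R y) < 0"
    unfolding expand q_def by (simp add: power2_eq_square algebra_simps)
  then show False using assms(1) by (simp add: psd_def not_le[symmetric])
qed

text \<open>Such a matrix is positive semidefinite with every vector isotropic, so
  \<open>psd_qform_eq_0\<close> puts every vector into its kernel.\<close>

lemma hermitian_qform_eq_0:
  assumes "dagger M = M" and "\<And>x. qform M x = 0"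
  shows "M = 0"
  by (metis assms matrix_eq matrix_vector_mult_0 psd_def psd_qform_eq_0 order_refl)

section \<open>Positivity of Lindblad evolutions\<close>

lemma bounded_linear_qform: "bounded_linear (\<lambda>M :: complex ^ 'n ^ 'n. qform M x)"
  by (simp add: linear_qform linear_linear)

text \<open>In this form the commutator enters only through \<open>X *v x\<close>, so its
  contribution is negligible where \<open>X *v x\<close> is small and \<open>H\<close> is
  bounded.\<close>

lemma qform_commutator:
  assumes "dagger H = H" and "dagger X = X"
  shows "qform (cscale (- \<i>) (H ** X - X ** H)) x = 2 * Im (cinner (H *v x) (X *v x))"
proof -
  have "cinner x (cscale (- \<i>) M *v x) = - \<i> * cinner x (M *v x)" for M :: "complex ^ 'a ^ 'a"
    by (simp add: cinner_def matrix_vector_mult_def sum_distrib_left mult_ac)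
  moreover have "cinner x ((H ** X - X ** H) *v x)
      = cinner (H *v x) (X *v x) - cinner (X *v x) (H *v x)"
    using assms
    by (simp add: linear_diff[OF linear_matvec_matrix] cinner_diff_right cinner_matvec
        flip: matrix_vector_mul_assoc)
  ultimately show ?thesis
    unfolding qform_def by (simp add: cinner_commute[of "X *v x"])
qed

text \<open>The sandwich terms are values of the form of \<open>X\<close> itself, so positivity
  controls their sign; the anticommutator enters only through \<open>X *v x\<close>.\<close>

lemma qform_lindblad:
  assumes "dagger X = X"
  shows "qform (lindblad K L X) x = (\<Sum>k<K. qform X (dagger (L k) *v x))
           - Re (cinner ((\<Sum>k<K. dagger (L k) ** L k) *v x) (X *v x))"
proof -
  define W where "W k = dagger (L k) ** L k" for k
  have W: "dagger (W k) = W k" for k by (simp add: W_def dagger_mult)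
  have "qform (L k ** X ** dagger (L k) - (1/2) *\<^sub>R (dagger (L k) ** L k ** X)
           - (1/2) *\<^sub>R (X ** dagger (L k) ** L k)) x
        = qform X (dagger (L k) *v x) - Re (cinner (W k *v x) (X *v x))" for k
  proof -
    have "qform (L k ** X ** dagger (L k)) x = qform X (dagger (L k) *v x)"
      by (simp add: qform_def cinner_matvec[of _ "L k"] flip: matrix_vector_mul_assoc)
    moreover have "qform (W k ** X) x = Re (cinner (W k *v x) (X *v x))"
      by (simp add: qform_def cinner_matvec[of _ "W k"] W flip: matrix_vector_mul_assoc)
    moreover have "qform (X ** W k) x = Re (cinner (W k *v x) (X *v x))"
      using assms by (simp add: qform_def cinner_matvec[of _ X] cinner_commute[of "X *v x"]
          flip: matrix_vector_mul_assoc)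
    ultimately show ?thesis
      by (simp add: linear_diff[OF linear_qform] linear_scale[OF linear_qform] W_def
          flip: matrix_mul_assoc)
  qed
  moreover have "cinner (\<Sum>k<K. z k) y = (\<Sum>k<K. cinner (z k) y)" for z :: "nat \<Rightarrow> complex ^ 'a" and y
    by (simp add: cinner_def sum_distrib_right sum.swap[of _ "{..<K}"])
  ultimately show ?thesis
    unfolding lindblad_def linear_sum[OF linear_qform] linear_sum[OF linear_matvec_matrix]
    by (simp add: sum_subtractf W_def)
qed

lemma continuous_on_qform:
  assumes "continuous_on S M" and "continuous_on S y"
  shows "continuous_on S (\<lambda>p. qform (M p) (y p))"
  unfolding qform_def cinner_def matrix_vector_mult_def
  using assms by (auto intro!: continuous_intros)

text \<open>Applied to \<open>lindblad K L (mat 1)\<close>, this provides the growth rate of the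
  perturbation used below.\<close>

lemma qform_le_norm_square: "\<exists>B. \<forall>x. \<bar>qform M x\<bar> \<le> B * (norm x)\<^sup>2"
proof -
  obtain B where B: "\<And>x. norm (M *v x) \<le> B * norm x"
    using linear_bounded[OF linear_matvec] by blast
  have "\<bar>qform M x\<bar> \<le> B * (norm x)\<^sup>2" for x
  proof -
    have "\<bar>qform M x\<bar> \<le> norm x * norm (M *v x)"
      unfolding qform_def by (rule order_trans[OF abs_Re_le_cmod norm_cinner_le])
    also have "\<dots> \<le> norm x * (B * norm x)" by (intro mult_left_mono B) simp
    finally show ?thesis by (simp add: power2_eq_square mult_ac)
  qed
  then show ?thesis by blast
qed

text \<open>
  The strict perturbation \<open>Y t = X t + e exp (c t) I\<close> keeps a positive form: at the first time at which
  \<open>qform (Y t)\<close> had a unit zero \<open>x\<close>, positivity forces \<open>Y t *v x = 0\<close>, so that near this time all terms of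
  \<open>d/dt qform (Y t) x\<close> are nonnegative or negligible, except \<open>e\<close> times a strictly positive one.
\<close>

lemma lindblad_flow_qform_pos:
  fixes X :: "real \<Rightarrow> complex ^ 'n ^ 'n"
  assumes cont: "continuous_on {0..T} X" and S: "finite S"
    and der: "\<And>t. t \<in> {0..T} - S \<Longrightarrow>
      (X has_vector_derivative cscale (- \<i>) (H t ** X t - X t ** H t) + lindblad K L (X t))
        (at t within {0..T})"
    and herm: "\<And>t. t \<in> {0..T} \<Longrightarrow> dagger (X t) = X t" "\<And>t. dagger (H t) = H t"
    and bdd: "bounded (H ` {0..T})"
    and init: "\<And>x. 0 \<le> qform (X 0) x"
    and c: "\<And>x. \<bar>qform (lindblad K L (mat 1)) x\<bar> \<le> (c - 1) * (norm x)\<^sup>2"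
    and e: "e > 0" and t: "t \<in> {0..T}" and x: "norm x = 1"
  shows "0 < qform (X t + (e * exp (c * t)) *\<^sub>R mat 1) x"
proof (rule ccontr)
  define Y where "Y t = X t + (e * exp (c * t)) *\<^sub>R (mat 1 :: complex ^ 'n ^ 'n)" for t
  \<comment> \<open>Pairs of a time and a unit vector at which strict positivity fails. The set is
    compact, so its projection to the time axis has a least element \<open>t0\<close>.\<close>
  define C where "C = {p \<in> {0..T} \<times> sphere 0 1. qform (Y (fst p)) (snd p) \<le> 0}"
  assume "\<not> 0 < qform (X t + (e * exp (c * t)) *\<^sub>R mat 1) x"
  then have "(t, x) \<in> C" using t x by (simp add: C_def Y_def)
  have contY: "continuous_on {0..T} Y"
    unfolding Y_def by (intro continuous_intros cont)
  have "continuous_on ({0..T} \<times> sphere 0 1) (\<lambda>p. qform (Y (fst p)) (snd p))"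
    by (intro continuous_on_qform continuous_on_compose2[OF contY] continuous_intros) auto
  then have "closed C"
    unfolding C_def
    by (intro continuous_on_closed_Collect_le closed_Times) auto
  then have "compact (({0..T} \<times> sphere 0 1) \<inter> C)"
    by (intro compact_Int_closed compact_Times) auto
  moreover have "({0..T} \<times> sphere 0 1) \<inter> C = C" by (auto simp: C_def)
  ultimately have "compact C" by simp
  then have "compact (fst ` C)" by (intro compact_continuous_image continuous_intros)
  then obtain t0 where t0: "t0 \<in> fst ` C" "\<And>s. s \<in> fst ` C \<Longrightarrow> t0 \<le> s"
    using \<open>(t, x) \<in> C\<close> compact_attains_inf[of "fst ` C"] by blast
  then obtain x0 where x0: "t0 \<in> {0..T}" "norm x0 = 1" "qform (Y t0) x0 \<le> 0"
    by (auto simp: C_def)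
  have qY: "qform (Y s) y = qform (X s) y + e * exp (c * s) * (norm y)\<^sup>2" for s y
    by (simp add: Y_def linear_add[OF linear_qform] linear_scale[OF linear_qform] qform_mat_1)
  have "0 < qform (Y 0) x0"
    unfolding qY using init[of x0] e x0(2) by simp
  then have "t0 > 0" using x0 by (cases "t0 = 0") auto
  have pos1: "0 < qform (Y s) y" if "0 \<le> s" "s < t0" "norm y = 1" for s y
  proof (rule ccontr)
    assume "\<not> 0 < qform (Y s) y"
    then have "(s, y) \<in> C" using that x0 by (simp add: C_def)
    then have "s \<in> fst ` C" by force
    then show False using t0(2) that by fastforce
  qed
  have pos: "0 \<le> qform (Y s) y" if "0 \<le> s" "s < t0" for s y
  proof (cases "y = 0")
    case False
    then have "0 < qform (Y s) ((1 / norm y) *\<^sub>R y)" using that by (intro pos1) auto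
    then show ?thesis unfolding qform_scaleR by (simp add: zero_less_mult_iff)
  qed (simp add: qform_def cinner_def)
  have hermY: "dagger (Y s) = Y s" if "s \<in> {0..T}" for s
    using that by (simp add: Y_def dagger_add dagger_scaleR dagger_mat_1 herm)
  have contq: "continuous_on {0..T} (\<lambda>s. qform (Y s) y)" for y
    by (intro continuous_on_qform contY continuous_intros)
  have lim: "(f \<longlongrightarrow> f t0) (at_left t0)" if "continuous_on {0..T} f" for f :: "real \<Rightarrow> 'b :: topological_space"
  proof -
    have "(f \<longlongrightarrow> f t0) (at t0 within {0..t0})"
      using that x0 by (meson atLeastatMost_subset_iff continuous_on_def continuous_on_subset
          order_refl atLeastAtMost_iff)
    then show ?thesis using \<open>t0 > 0\<close> by (simp add: at_within_Icc_at_left)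
  qed
  have ev: "\<forall>\<^sub>F s in at_left t0. 0 \<le> s \<and> s < t0"
    using eventually_at_left_real[OF \<open>t0 > 0\<close>] by eventually_elim auto
  have "0 \<le> qform (Y t0) y" for y
    by (rule tendsto_lowerbound[OF lim[OF contq]])
      (use ev pos in \<open>auto elim: eventually_mono\<close>)
  then have "psd (Y t0)" using hermY x0 by (simp add: psd_def)
  moreover have "qform (Y t0) x0 = 0"
    using x0 \<open>psd (Y t0)\<close> by (simp add: psd_def order_antisym)
  ultimately have zero: "Y t0 *v x0 = 0" by (rule psd_qform_eq_0)

  define W where "W = (\<Sum>k<K. dagger (L k) ** L k)"
  have "bounded ((\<lambda>M. M *v x0) ` H ` {0..T})"
    by (intro bounded_linear_image bdd) (simp add: linear_matvec_matrix linear_linear)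
  \<comment> \<open>\<open>H\<close> may jump, so no limit of \<open>H s\<close> at
    \<open>t0\<close> is available and a uniform bound takes its place.\<close>
  then obtain h where h: "\<And>s. s \<in> {0..T} \<Longrightarrow> norm (H s *v x0) \<le> h"
    unfolding bounded_iff by blast
  have "((\<lambda>s. (2 * h + norm (W *v x0)) * norm (Y s *v x0)) \<longlongrightarrow> (2 * h + norm (W *v x0)) * norm (Y t0 *v x0)) (at_left t0)"
    by (intro lim continuous_intros continuous_on_mult_const)
      (auto simp: matrix_vector_mult_def intro!: continuous_intros contY)
  then have small: "\<forall>\<^sub>F s in at_left t0. (2 * h + norm (W *v x0)) * norm (Y s *v x0) < e"
    unfolding zero using e by (auto intro: order_tendstoD)
  have "\<forall>\<^sub>F s in at t0. s \<notin> S"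
    using S islimpt_finite islimpt_iff_eventually by blast
  then have "\<forall>\<^sub>F s in at_left t0. s \<notin> S"
    by (metis eventually_at_split)
  with small ev have "\<forall>\<^sub>F s in at_left t0. (2 * h + norm (W *v x0)) * norm (Y s *v x0) < e
      \<and> s \<notin> S \<and> 0 \<le> s"
    by eventually_elim auto
  then obtain b where b: "b < t0" and
    near: "\<And>s. b < s \<Longrightarrow> s < t0 \<Longrightarrow> (2 * h + norm (W *v x0)) * norm (Y s *v x0) < e \<and> s \<notin> S \<and> 0 \<le> s"
    unfolding eventually_at_left_field by blast
  \<comment> \<open>The midpoint of \<open>max b 0\<close> and \<open>t0\<close>: no exceptional
    times lie between \<open>a\<close> and \<open>t0\<close>, and \<open>a > 0\<close> makes the
    derivatives there two-sided.\<close>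
  define a where "a = (max b 0 + t0) / 2"
  have a: "b < a" "0 < a" "a < t0" using b \<open>t0 > 0\<close> by (auto simp: a_def)
  define F where "F s = qform (cscale (- \<i>) (H s ** X s - X s ** H s) + lindblad K L (X s)) x0
    + e * (c * exp (c * s))" for s
  have der': "((\<lambda>s. qform (Y s) x0) has_real_derivative F s) (at s)" if "a < s" "s < t0" for s
  proof -
    have "s \<in> {0..T} - S" and "s \<in> interior {0..T}"
      using that a x0 near[of s] by auto
    then have "(X has_vector_derivative cscale (- \<i>) (H s ** X s - X s ** H s) + lindblad K L (X s)) (at s)"
      using der by (metis at_within_interior)
    then have "((\<lambda>s. qform (X s) x0) has_vector_derivative
        qform (cscale (- \<i>) (H s ** X s - X s ** H s) + lindblad K L (X s)) x0) (at s)"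
      by (rule bounded_linear.has_vector_derivative[OF bounded_linear_qform])
    then show ?thesis
      unfolding qY F_def x0(2) has_real_derivative_iff_has_vector_derivative[symmetric]
      by (auto intro!: derivative_eq_intros)
  qed
  have Fpos: "F s > 0" if s: "a < s" "s < t0" for s
  proof -
    have sT: "s \<in> {0..T}" using s a x0 by auto
    define r where "r = e * exp (c * s)"
    \<comment> \<open>The second inequality amounts to \<open>r \<ge> e\<close>: the hypothesis on
      \<open>c\<close> forces \<open>c \<ge> 1\<close>, so the exponential is at least 1. The margin
      \<open>e\<close> absorbs the term estimated in \<open>small\<close>.\<close>
    have r: "r \<ge> 0" "r * c \<ge> r * (c - 1) + e"
      using e c[of x0] x0 a s order_trans[OF abs_ge_zero c[of x0]] by (auto simp: r_def algebra_simps)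
    have X: "X s = Y s - r *\<^sub>R mat 1" by (simp add: Y_def r_def)
    have "qform (lindblad K L (X s)) x0
        = qform (lindblad K L (Y s)) x0 - r * qform (lindblad K L (mat 1)) x0"
      unfolding X by (simp add: linear_diff[OF linear_lindblad] linear_scale[OF linear_lindblad]
          linear_diff[OF linear_qform] linear_scale[OF linear_qform])
    moreover have "H s ** X s - X s ** H s = H s ** Y s - Y s ** H s"
      unfolding X by (simp add: linear_diff[OF linear_matmul_left] linear_scale[OF linear_matmul_left]
          linear_diff[OF linear_matmul_right] linear_scale[OF linear_matmul_right])
    ultimately have "F s = (\<Sum>k<K. qform (Y s) (dagger (L k) *v x0)) - Re (cinner (W *v x0) (Y s *v x0))
        + 2 * Im (cinner (H s *v x0) (Y s *v x0)) - r * qform (lindblad K L (mat 1)) x0 + r * c"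
      unfolding F_def linear_add[OF linear_qform]
      by (simp add: qform_commutator[OF herm(2) hermY[OF sT]] qform_lindblad[OF hermY[OF sT]]
          W_def r_def)
    moreover have "(\<Sum>k<K. qform (Y s) (dagger (L k) *v x0)) \<ge> 0"
      using s a by (intro sum_nonneg pos) auto
    moreover have "Re (cinner (W *v x0) (Y s *v x0)) \<le> norm (W *v x0) * norm (Y s *v x0)"
      using norm_cinner_le complex_Re_le_cmod order_trans by blast
    moreover have "- Im (cinner (H s *v x0) (Y s *v x0)) \<le> h * norm (Y s *v x0)"
    proof -
      have "- Im (cinner (H s *v x0) (Y s *v x0)) \<le> norm (H s *v x0) * norm (Y s *v x0)"
        using norm_cinner_le[of "H s *v x0" "Y s *v x0"] abs_Im_le_cmod[of "cinner (H s *v x0) (Y s *v x0)"]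
        by linarith
      also have "\<dots> \<le> h * norm (Y s *v x0)" by (intro mult_right_mono h sT) simp
      finally show ?thesis .
    qed
    moreover have "r * qform (lindblad K L (mat 1)) x0 \<le> r * (c - 1)"
      using c[of x0] x0 r by (intro mult_left_mono) auto
    moreover have "(2 * h + norm (W *v x0)) * norm (Y s *v x0) < e"
      using near s a by auto
    ultimately show ?thesis using r by (simp add: algebra_simps)
  qed
  \<comment> \<open>The form increases strictly on \<open>{a..t0}\<close>, so its value at
    \<open>a\<close> lies below the nonpositive value at \<open>t0\<close>, against
    \<open>pos\<close>.\<close>
  have "continuous_on {a..t0} (\<lambda>s. qform (Y s) x0)"
    by (rule continuous_on_subset[OF contq]) (use a x0 in auto)
  then have "qform (Y a) x0 < qform (Y t0) x0"
    by (rule DERIV_pos_imp_increasing_open[OF a(3), rotated])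
      (use der' Fpos in blast)
  then show False
    using pos[of a x0] a x0 by auto
qed


section \<open>Positivity, Hermiticity and trace along a Lindblad flow\<close>

text \<open>The equation of \<open>master_solution\<close> in any dimension and with any jump
  operators, since preservation of positivity does not depend on the tensor structure.\<close>

definition lindblad_flow ::
    "real \<Rightarrow> (real \<Rightarrow> complex ^ 'n ^ 'n) \<Rightarrow> nat \<Rightarrow> (nat \<Rightarrow> complex ^ 'n ^ 'n) \<Rightarrow> (real \<Rightarrow> complex ^ 'n ^ 'n) \<Rightarrow> bool"
  where "lindblad_flow T H K L X \<longleftrightarrow>
    continuous_on {0..T} X \<and>
    (\<exists>S. finite S \<and>
       (\<forall>t\<in>{0..T} - S.
          (X has_vector_derivative cscale (- \<i>) (H t ** X t - X t ** H t) + lindblad K L (X t))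
            (at t within {0..T})))"

text \<open>Removes the perturbation from \<open>lindblad_flow_qform_pos\<close>, whose parameter
  \<open>e > 0\<close> is arbitrary; scaling covers vectors that are not of unit length.\<close>

lemma lindblad_flow_hermitian_qform_nonneg:
  assumes flow: "lindblad_flow T H K L X"
    and H: "\<And>t. dagger (H t) = H t" "bounded (H ` {0..T})"
    and herm: "\<And>t. t \<in> {0..T} \<Longrightarrow> dagger (X t) = X t"
    and init: "\<And>x. 0 \<le> qform (X 0) x" and t: "t \<in> {0..T}"
  shows "0 \<le> qform (X t) x"
proof -
  obtain S where S: "finite S" "\<And>t. t \<in> {0..T} - S \<Longrightarrow>
      (X has_vector_derivative cscale (- \<i>) (H t ** X t - X t ** H t) + lindblad K L (X t))
        (at t within {0..T})" and cont: "continuous_on {0..T} X"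
    using flow unfolding lindblad_flow_def by blast
  obtain B where B: "\<And>x. \<bar>qform (lindblad K L (mat 1)) x\<bar> \<le> B * (norm x)\<^sup>2"
    using qform_le_norm_square by blast
  have unit: "0 \<le> qform (X t) y" if y: "norm y = 1" for y
  proof (rule ccontr)
    assume neg: "\<not> 0 \<le> qform (X t) y"
    \<comment> \<open>Chosen so that the perturbation exactly cancels the negative value at time
      \<open>t\<close>.\<close>
    define e where "e = - qform (X t) y / exp ((B + 1) * t)"
    have "e > 0" using neg by (simp add: e_def divide_neg_pos)
    then have "0 < qform (X t + (e * exp ((B + 1) * t)) *\<^sub>R mat 1) y"
      by (intro lindblad_flow_qform_pos[OF cont S herm H init _ _ t y])
        (simp_all add: B)
    also have "qform (X t + (e * exp ((B + 1) * t)) *\<^sub>R mat 1) y = 0"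
      by (simp add: linear_diff[OF linear_qform] linear_scale[OF linear_qform] qform_mat_1 y e_def)
    finally show False by simp
  qed
  show ?thesis
  proof (cases "x = 0")
    case False
    then have "0 \<le> qform (X t) ((1 / norm x) *\<^sub>R x)" by (intro unit) auto
    then show ?thesis unfolding qform_scaleR using False by (simp add: zero_le_mult_iff)
  qed (simp add: qform_def cinner_def)
qed

text \<open>Used for negation and for \<open>\<i>\<close> times the difference of a matrix and its
  adjoint, both of which commute with the generator.\<close>

lemma lindblad_flow_compose:
  assumes flow: "lindblad_flow T H K L X" and f: "linear f"
    and gen: "\<And>t M. f (cscale (- \<i>) (H t ** M - M ** H t) + lindblad K L M)
      = cscale (- \<i>) (H t ** f M - f M ** H t) + lindblad K L (f M)"
  shows "lindblad_flow T H K L (\<lambda>t. f (X t))"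
proof -
  have "bounded_linear f" using f by (simp add: linear_linear)
  then show ?thesis
    using flow unfolding lindblad_flow_def gen[symmetric]
    by (blast intro: bounded_linear.continuous_on bounded_linear.has_vector_derivative)
qed

text \<open>Positivity applies to \<open>X\<close> and to \<open>- X\<close>, both of which start at
  zero; this takes the place of a uniqueness theorem for Hermitian solutions.\<close>

lemma lindblad_flow_hermitian_0:
  assumes flow: "lindblad_flow T H K L X"
    and H: "\<And>t. dagger (H t) = H t" "bounded (H ` {0..T})"
    and herm: "\<And>t. t \<in> {0..T} \<Longrightarrow> dagger (X t) = X t"
    and init: "X 0 = 0" and t: "t \<in> {0..T}"
  shows "X t = 0"
proof (rule hermitian_qform_eq_0[OF herm[OF t]])
  fix x
  have "0 \<le> qform (X t) x"
    by (rule lindblad_flow_hermitian_qform_nonneg[OF flow H herm _ t])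
      (simp_all add: init linear_0[OF linear_qform])
  moreover have "lindblad_flow T H K L (\<lambda>t. - X t)"
    by (rule lindblad_flow_compose[OF flow])
      (simp_all add: linear_neg[OF linear_lindblad] linear_neg[OF linear_commutator] linear_iff)
  then have "0 \<le> qform (- X t) x"
    by (rule lindblad_flow_hermitian_qform_nonneg[OF _ H _ _ t])
      (simp_all add: init linear_0[OF linear_qform] linear_neg[OF linear_dagger] herm)
  ultimately show "qform (X t) x = 0" by (simp add: linear_neg[OF linear_qform])
qed

text \<open>The positivity result above presupposes a Hermitian solution, whereas here only the
  initial value is known to be Hermitian. The anti-Hermitian part is therefore shown to stay zero
  first.\<close>

lemma lindblad_flow_psd:
  assumes flow: "lindblad_flow T H K L X"
    and H: "\<And>t. dagger (H t) = H t" "bounded (H ` {0..T})"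
    and init: "psd (X 0)" and t: "t \<in> {0..T}"
  shows "psd (X t)"
proof -
  \<comment> \<open>The factor \<open>\<i>\<close> makes the anti-Hermitian difference Hermitian, so
    that \<open>lindblad_flow_hermitian_0\<close> applies to it.\<close>
  define f :: "complex ^ 'a ^ 'a \<Rightarrow> complex ^ 'a ^ 'a" where "f M = cscale \<i> (M - dagger M)" for M
  have f: "linear f"
    unfolding f_def
    by (intro linear_compose[OF _ linear_cscale, unfolded o_def] linear_compose_sub linear_dagger linear_id[unfolded id_def])
  have comm: "dagger (cscale (- \<i>) (H t ** M - M ** H t))
      = cscale (- \<i>) (H t ** dagger M - dagger M ** H t)" for t and M :: "complex ^ 'a ^ 'a"
    by (simp add: dagger_cscale dagger_diff dagger_mult H vec_eq_iff algebra_simps)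
  have "f (cscale (- \<i>) (H t ** M - M ** H t) + lindblad K L M)
      = cscale (- \<i>) (H t ** f M - f M ** H t) + lindblad K L (f M)" for t M
  proof -
    have "f (cscale (- \<i>) (H t ** M - M ** H t) + lindblad K L M)
        = cscale \<i> (cscale (- \<i>) (H t ** (M - dagger M) - (M - dagger M) ** H t)
            + lindblad K L (M - dagger M))"
      unfolding f_def dagger_add comm lindblad_dagger[symmetric] linear_diff[OF linear_lindblad]
        linear_diff[OF linear_commutator] by (simp add: algebra_simps)
    moreover have "cscale \<i> (cscale (- \<i>) (A - B)) = cscale (- \<i>) (cscale \<i> A - cscale \<i> B)"
      for A B :: "complex ^ 'a ^ 'a"
      by (simp add: vec_eq_iff algebra_simps)
    ultimately show ?thesis
      by (simp add: f_def lindblad_cscale linear_add[OF linear_cscale] cscale_mult_left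
          cscale_mult_right)
  qed
  then have flow': "lindblad_flow T H K L (\<lambda>t. f (X t))"
    using f by (intro lindblad_flow_compose[OF flow]) auto
  have herm': "dagger (f M) = f M" for M
    by (simp add: f_def vec_eq_iff algebra_simps)
  have init': "f (X 0) = 0"
    using init by (simp add: f_def psd_def linear_0[OF linear_cscale])
  have zero: "f (X t) = 0" if "t \<in> {0..T}" for t
    by (rule lindblad_flow_hermitian_0[OF flow' H herm' init' that])
  have herm: "dagger (X t) = X t" if "t \<in> {0..T}" for t
  proof -
    have "cscale \<i> M = 0 \<Longrightarrow> M = 0" for M :: "complex ^ 'a ^ 'a"
      by (simp add: vec_eq_iff)
    then have "X t - dagger (X t) = 0" using zero[OF that] unfolding f_def .
    then show ?thesis by simp
  qed
  have "0 \<le> qform (X t) x" for x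
    by (rule lindblad_flow_hermitian_qform_nonneg[OF flow H herm _ t]) (use init in \<open>simp_all add: psd_def\<close>)
  with herm[OF t] show ?thesis by (simp add: psd_def)
qed

text \<open>Commutator and dissipator are traceless, and continuity bridges the finitely many
  exceptional times.\<close>

lemma lindblad_flow_trace:
  assumes flow: "lindblad_flow T H K L X" and t: "t \<in> {0..T}"
  shows "trace (X t) = trace (X 0)"
proof -
  obtain S where S: "finite S" "\<And>t. t \<in> {0..T} - S \<Longrightarrow>
      (X has_vector_derivative cscale (- \<i>) (H t ** X t - X t ** H t) + lindblad K L (X t))
        (at t within {0..T})" and cont: "continuous_on {0..T} X"
    using flow unfolding lindblad_flow_def by blast
  have tr: "bounded_linear (trace :: complex ^ 'a ^ 'a \<Rightarrow> complex)"
    unfolding linear_linear by (rule linearI) (simp_all add: trace_add trace_scaleR)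
  show ?thesis
  proof (rule has_derivative_zero_unique_strong_interval[OF S(1) _ refl _ t])
    show "continuous_on {0..T} (\<lambda>t. trace (X t))"
      by (rule bounded_linear.continuous_on[OF tr cont])
    fix s assume "s \<in> {0..T} - S"
    then have "((\<lambda>t. trace (X t)) has_vector_derivative
        trace (cscale (- \<i>) (H s ** X s - X s ** H s) + lindblad K L (X s))) (at s within {0..T})"
      by (intro bounded_linear.has_vector_derivative[OF tr] S)
    moreover have "trace (H s ** X s) = trace (X s ** H s)" by (rule trace_mul_sym)
    ultimately show "((\<lambda>t. trace (X t)) has_derivative (\<lambda>h. 0)) (at s within {0..T})"
      by (simp add: trace_add trace_sub trace_cscale trace_lindblad has_vector_derivative_def)
  qed
qed

lemma lindblad_flow_density_matrix:
  assumes "lindblad_flow T H K L X" and "\<And>t. dagger (H t) = H t" and "bounded (H ` {0..T})"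
    and "density_matrix (X 0)" and "t \<in> {0..T}"
  shows "density_matrix (X t)"
  using assms lindblad_flow_psd lindblad_flow_trace unfolding density_matrix_iff by metis

section \<open>Blocks of two-qubit states\<close>

lemma sum_UNIV_pair: "(\<Sum>p\<in>(UNIV :: ('a::finite \<times> 'b::finite) set). f p) = (\<Sum>i\<in>UNIV. \<Sum>k\<in>UNIV. f (i, k))"
  by (simp add: sum.cartesian_product flip: UNIV_Times_UNIV)

lemma pauli_nth [simp]:
  "pauli 1 $ 1 $ 1 = 0" "pauli 1 $ 1 $ 2 = 1" "pauli 1 $ 2 $ 1 = 1" "pauli 1 $ 2 $ 2 = 0"
  "pauli 2 $ 1 $ 1 = 0" "pauli 2 $ 1 $ 2 = - \<i>" "pauli 2 $ 2 $ 1 = \<i>" "pauli 2 $ 2 $ 2 = 0"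
  "pauli 3 $ 1 $ 1 = 1" "pauli 3 $ 1 $ 2 = 0" "pauli 3 $ 2 $ 1 = 0" "pauli 3 $ 2 $ 2 = - 1"
  by (simp_all add: pauli_def)

lemma dagger_pauli [simp]: "dagger (pauli j) = pauli j"
  using exhaust_3[of j] by (auto simp: vec_eq_iff forall_2)

lemma trace_2: "trace (M :: complex ^ 2 ^ 2) = M $ 1 $ 1 + M $ 2 $ 2"
  by (simp add: trace_def sum_2)

lemma matmul_2: "((M :: complex ^ 2 ^ 2) ** N) $ i $ j = M $ i $ 1 * N $ 1 $ j + M $ i $ 2 * N $ 2 $ j"
  by (simp add: matrix_matrix_mult_def sum_2)

section \<open>Self-adjointness and boundedness of the controlled Hamiltonian\<close>

lemma dagger_hamiltonian:
  assumes "dagger HI = HI"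
  shows "dagger (hamiltonian \<omega>a \<omega>b HI u) = hamiltonian \<omega>a \<omega>b HI u"
  using assms
  by (simp add: hamiltonian_def dagger_add dagger_kron dagger_scaleR dagger_sum dagger_mat_1)

lemma continuous_on_hamiltonian: "continuous_on S (hamiltonian \<omega>a \<omega>b HI)"
  unfolding hamiltonian_def kron_def by (intro continuous_intros)

text \<open>Each piece agrees inside its interval with a function continuous on the closed interval;
  induction collects the pieces.\<close>

lemma piecewise_smooth_bounded:
  assumes "piecewise_smooth T u"
  shows "bounded (u ` {0..T})"
proof -
  obtain n p where p: "p 0 = 0" "p n = T" and
    piece: "\<And>i. i < n \<Longrightarrow> p i < p (Suc i) \<and>
      (\<exists>w. smooth_on_Icc w (p i) (p (Suc i)) \<and> (\<forall>t\<in>{p i<..<p (Suc i)}. u t = w t))"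
    using assms unfolding piecewise_smooth_def by blast
  have "m \<le> n \<Longrightarrow> bounded (u ` {0..p m})" for m
  proof (induction m)
    case (Suc m)
    obtain w where w: "smooth_on_Icc w (p m) (p (Suc m))" "\<And>t. t \<in> {p m<..<p (Suc m)} \<Longrightarrow> u t = w t"
      using piece[of m] Suc.prems by auto
    obtain D where D: "\<And>t. t \<in> {p m..p (Suc m)} \<Longrightarrow> D 0 t = w t"
      "\<And>k t. t \<in> {p m..p (Suc m)} \<Longrightarrow> (D k has_vector_derivative D (Suc k) t) (at t within {p m..p (Suc m)})"
      using w(1) unfolding smooth_on_Icc_def by blast
    have "continuous_on {p m..p (Suc m)} (D 0)"
      by (intro continuous_on_vector_derivative[of _ _ "D (Suc 0)"] D)
    then have "bounded (D 0 ` {p m..p (Suc m)})"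
      by (intro compact_imp_bounded compact_continuous_image) auto
    \<comment> \<open>The value of \<open>u\<close> at a break point is arbitrary, hence the
      separate singleton.\<close>
    moreover have "u ` {0..p (Suc m)} \<subseteq> u ` {0..p m} \<union> D 0 ` {p m..p (Suc m)} \<union> {u (p (Suc m))}"
    proof
      fix y assume "y \<in> u ` {0..p (Suc m)}"
      then obtain t where t: "y = u t" "0 \<le> t" "t \<le> p (Suc m)" by auto
      consider "t \<le> p m" | "p m < t" "t < p (Suc m)" | "t = p (Suc m)" using t by linarith
      then show "y \<in> u ` {0..p m} \<union> D 0 ` {p m..p (Suc m)} \<union> {u (p (Suc m))}"
      proof cases
        case 2
        then have "y = D 0 t" using t w(2)[of t] D(1)[of t] by simp
        then show ?thesis using 2 by auto
      qed (use t in auto)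
    qed
    moreover have "bounded (u ` {0..p m})" using Suc by simp
    ultimately show ?case
      by - (rule bounded_subset[of "u ` {0..p m} \<union> D 0 ` {p m..p (Suc m)} \<union> {u (p (Suc m))}"],
          simp_all add: bounded_Un)
  qed (simp add: p)
  then show ?thesis using p by auto
qed

lemma bounded_hamiltonian:
  assumes "piecewise_smooth T u"
  shows "bounded ((\<lambda>t. hamiltonian \<omega>a \<omega>b HI (u t)) ` {0..T})"
proof -
  have "compact (hamiltonian \<omega>a \<omega>b HI ` closure (u ` {0..T}))"
    using piecewise_smooth_bounded[OF assms]
    by (intro compact_continuous_image continuous_on_hamiltonian) (simp add: compact_closure)
  then show ?thesis
    by (rule bounded_subset[OF compact_imp_bounded]) (use closure_subset in blast)
qed

section \<open>Block decomposition with respect to the second factor\<close>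

text \<open>In bra-ket notation this is \<open>(I \<otimes> <k|) M (I \<otimes> |l>)\<close>, an
  operator on the first factor.\<close>

definition block :: "'b::finite \<Rightarrow> 'b \<Rightarrow> complex ^ ('a::finite \<times> 'b) ^ ('a \<times> 'b) \<Rightarrow> complex ^ 'a ^ 'a"
  where "block k l M = (\<chi> i j. M $ (i, k) $ (j, l))"

lemma block_nth [simp]: "block k l M $ i $ j = M $ (i, k) $ (j, l)"
  by (simp add: block_def)

lemma linear_block: "linear (block k l)"
  by (rule linearI) (simp_all add: vec_eq_iff)

lemma bounded_linear_block:
  "bounded_linear (block k l :: complex ^ ('a::finite \<times> 'b::finite) ^ ('a \<times> 'b) \<Rightarrow> _)"
  by (simp add: linear_block linear_linear)

lemma block_kron_mult:
  "block k l ((M \<otimes>\<^sub>K N) ** X) = (\<Sum>m\<in>UNIV. cscale (N $ k $ m) (M ** block m l X))"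
proof -
  have "block k l ((M \<otimes>\<^sub>K N) ** X) $ i $ j
      = (\<Sum>m\<in>UNIV. \<Sum>n\<in>UNIV. (M $ i $ n * N $ k $ m) * X $ (n, m) $ (j, l))" for i j
    by (subst sum.swap) (simp add: matrix_matrix_mult_def sum_UNIV_pair)
  then show ?thesis
    by (simp add: vec_eq_iff matrix_matrix_mult_def sum_distrib_left mult_ac)
qed

lemma block_mult_kron:
  "block k l (X ** (M \<otimes>\<^sub>K N)) = (\<Sum>m\<in>UNIV. cscale (N $ m $ l) (block k m X ** M))"
proof -
  have "block k l (X ** (M \<otimes>\<^sub>K N)) $ i $ j
      = (\<Sum>m\<in>UNIV. \<Sum>n\<in>UNIV. X $ (i, k) $ (n, m) * (M $ n $ j * N $ m $ l))" for i j
    by (subst sum.swap) (simp add: matrix_matrix_mult_def sum_UNIV_pair)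
  then show ?thesis
    by (simp add: vec_eq_iff matrix_matrix_mult_def sum_distrib_left mult_ac)
qed

lemma cscale_if: "cscale (if P then 1 else 0) M = (if P then M else 0)"
  by (simp add: vec_eq_iff)

lemma block_kron_1_mult: "block k l ((M \<otimes>\<^sub>K mat 1) ** X) = M ** block k l X"
  and block_mult_kron_1: "block k l (X ** (M \<otimes>\<^sub>K mat 1)) = block k l X ** M"
  by (simp_all add: block_kron_mult block_mult_kron mat_def cscale_if)

lemma block_lindblad:
  "block k l (lindblad K (\<lambda>k. \<l> k \<otimes>\<^sub>K mat 1) X) = lindblad K \<l> (block k l X)"
proof -
  have "block k l (A \<otimes>\<^sub>K mat 1 ** B \<otimes>\<^sub>K mat 1 ** X) = A ** B ** block k l X" for A B
    by (simp add: block_kron_1_mult flip: matrix_mul_assoc)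
  then show ?thesis
    by (simp add: lindblad_def linear_sum[OF linear_block] linear_diff[OF linear_block]
        linear_scale[OF linear_block] dagger_kron dagger_mat_1 block_kron_1_mult block_mult_kron_1)
qed

text \<open>The Hamiltonian felt by A when B is in basis state \<open>k\<close>:
  \<open>pauli 3\<close> on B is replaced by its eigenvalue.\<close>

definition block_hamiltonian :: "real \<Rightarrow> real \<Rightarrow> real \<Rightarrow> real ^ 3 \<Rightarrow> 2 \<Rightarrow> cmat2"
  where "block_hamiltonian g \<omega>a \<omega>b u k =
    (1/2) *\<^sub>R (\<omega>a *\<^sub>R pauli 3 + (\<Sum>j\<in>UNIV. u $ j *\<^sub>R pauli j))
    + (if k = 1 then 1 else - 1) *\<^sub>R ((g / 2) *\<^sub>R pauli 3 + (\<omega>b / 2) *\<^sub>R mat 1)"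

text \<open>The second tensor factors occurring in \<open>H\<close> are all diagonal, so
  multiplication by \<open>H\<close> does not mix blocks.\<close>

lemma block_hamiltonian_mult:
  assumes "H = hamiltonian \<omega>a \<omega>b ((g / 2) *\<^sub>R (pauli 3 \<otimes>\<^sub>K pauli 3)) u"
  shows "block k l (H ** X) = block_hamiltonian g \<omega>a \<omega>b u k ** block k l X"
    and "block k l (X ** H) = block k l X ** block_hamiltonian g \<omega>a \<omega>b u l"
proof -
  define h where "h = (1/2) *\<^sub>R (\<omega>a *\<^sub>R pauli 3 + (\<Sum>j\<in>UNIV. u $ j *\<^sub>R pauli j))"
  \<comment> \<open>The scalar of the \<open>\<omega>b\<close> term moves to the first factor, so
    that the last two summands both have \<open>pauli 3\<close> as second factor.\<close>
  have H: "H = h \<otimes>\<^sub>K mat 1 + ((g / 2) *\<^sub>R pauli 3) \<otimes>\<^sub>K pauli 3 + ((\<omega>b / 2) *\<^sub>R mat 1) \<otimes>\<^sub>K pauli 3"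
    unfolding assms hamiltonian_def h_def[symmetric] by (simp add: kron_def vec_eq_iff)
  have left: "block k l ((M \<otimes>\<^sub>K pauli 3) ** X) = ((if k = 1 then 1 else - 1) *\<^sub>R M) ** block k l X" for M
    using exhaust_2[of k]
    by (auto simp: block_kron_mult sum_2 vec_eq_iff matmul_2)
  have right: "block k l (X ** (M \<otimes>\<^sub>K pauli 3)) = block k l X ** ((if l = 1 then 1 else - 1) *\<^sub>R M)" for M
    using exhaust_2[of l]
    by (auto simp: block_mult_kron sum_2 vec_eq_iff matmul_2)
  have hk: "block_hamiltonian g \<omega>a \<omega>b u k = h + (if k = 1 then 1 else - 1) *\<^sub>R ((g / 2) *\<^sub>R pauli 3)
      + (if k = 1 then 1 else - 1) *\<^sub>R ((\<omega>b / 2) *\<^sub>R mat 1)" for k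
    by (simp only: block_hamiltonian_def h_def scaleR_add_right add.assoc)
  show "block k l (H ** X) = block_hamiltonian g \<omega>a \<omega>b u k ** block k l X"
    unfolding H linear_add[OF linear_matmul_right] linear_add[OF linear_block] left block_kron_1_mult
      hk by simp
  show "block k l (X ** H) = block k l X ** block_hamiltonian g \<omega>a \<omega>b u l"
    unfolding H linear_add[OF linear_matmul_left] linear_add[OF linear_block] right block_mult_kron_1
      hk by simp
qed

lemma block_master_rhs:
  assumes "H = hamiltonian \<omega>a \<omega>b ((g / 2) *\<^sub>R (pauli 3 \<otimes>\<^sub>K pauli 3)) u"
  shows "block k l (master_rhs H K \<l> X) =
    cscale (- \<i>) (block_hamiltonian g \<omega>a \<omega>b u k ** block k l X - block k l X ** block_hamiltonian g \<omega>a \<omega>b u l)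
    + lindblad K \<l> (block k l X)"
proof -
  have "block k l (cscale c M) = cscale c (block k l M)" for c and M :: cmat4
    by (simp add: vec_eq_iff)
  then show ?thesis
    by (simp add: master_rhs_def linear_add[OF linear_block] linear_diff[OF linear_block]
        block_lindblad block_hamiltonian_mult[OF assms])
qed

section \<open>Reduced states and Bloch vectors in terms of blocks\<close>

lemma ptrace_A_nth: "ptrace_A M $ k $ l = trace (block k l M)"
  by (simp add: ptrace_A_def trace_def)

text \<open>The control and the \<open>\<omega>a\<close> term are common to both block Hamiltonians
  and cancel; this is why the motion of B does not see the control.\<close>

lemma block_hamiltonian_diff:
  "block_hamiltonian g \<omega>a \<omega>b u 1 - block_hamiltonian g \<omega>a \<omega>b u 2 = g *\<^sub>R pauli 3 + \<omega>b *\<^sub>R mat 1"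
  by (simp add: block_hamiltonian_def vec_eq_iff forall_2 mat_def) (simp add: scaleR_conv_of_real)

lemma v_B_nth:
  "v_B \<rho> $ 1 = (ptrace_A \<rho> $ 1 $ 2 + ptrace_A \<rho> $ 2 $ 1) / 2"
  "v_B \<rho> $ 2 = \<i> * (ptrace_A \<rho> $ 1 $ 2 - ptrace_A \<rho> $ 2 $ 1) / 2"
  "v_B \<rho> $ 3 = (ptrace_A \<rho> $ 1 $ 1 - ptrace_A \<rho> $ 2 $ 2) / 2"
  by (simp_all add: v_B_def trace_def ptrace_A_def matrix_matrix_mult_def sum_UNIV_pair sum_2 mat_def
      algebra_simps)

lemma trace_eq_blocks: "trace \<rho> = trace (block 1 1 \<rho>) + trace (block 2 2 \<rho>)" for \<rho> :: cmat4
  by (simp add: trace_def sum_UNIV_pair sum_2)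

lemma v_A_nth:
  assumes "\<rho>A = block 1 1 \<rho> + block 2 2 \<rho>"
  shows "v_A \<rho> $ i = trace (pauli i ** \<rho>A) / 2"
  using exhaust_3[of i]
  by (auto simp: assms v_A_def trace_def matrix_matrix_mult_def sum_UNIV_pair sum_2 mat_def
      algebra_simps)

text \<open>
  A pure reduced state \<open>B\<close> has the kernel vectors \<open>(B\<^sub>1\<^sub>2, - B\<^sub>1\<^sub>1)\<close> and \<open>(B\<^sub>2\<^sub>2, - B\<^sub>2\<^sub>1)\<close>; by positivity the
  whole state annihilates \<open>e\<^sub>i \<otimes> \<psi>\<close> for each kernel vector \<open>\<psi>\<close>.
\<close>

lemma kernel_ptrace_A:
  fixes \<rho> :: cmat4
  assumes psd: "psd \<rho>"
    and kernel: "ptrace_A \<rho> $ 1 $ 1 * a + ptrace_A \<rho> $ 1 $ 2 * b = 0"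
      "ptrace_A \<rho> $ 2 $ 1 * a + ptrace_A \<rho> $ 2 $ 2 * b = 0"
  shows "cscale a (block k 1 \<rho>) + cscale b (block k 2 \<rho>) = 0"
proof -
  define x :: "2 \<Rightarrow> complex ^ (2 \<times> 2)"
    where "x i = (\<chi> p. if fst p = i then if snd p = 1 then a else b else 0)" for i
  have mv: "(\<rho> *v x i) $ (j, k) = \<rho> $ (j, k) $ (i, 1) * a + \<rho> $ (j, k) $ (i, 2) * b" for i j k
    using exhaust_2[of i] by (auto simp: matrix_vector_mult_def sum_UNIV_pair sum_2 x_def)
  have cx: "cinner (x i) y = cnj a * y $ (i, 1) + cnj b * y $ (i, 2)" for i y
    using exhaust_2[of i] by (auto simp: cinner_def sum_UNIV_pair sum_2 x_def)
  \<comment> \<open>Summing over the basis of A turns the forms of \<open>\<rho>\<close> into the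
    form of its reduced state at \<open>(a, b)\<close>. That value is zero, so both nonnegative
    summands vanish.\<close>
  have "cinner (x 1) (\<rho> *v x 1) + cinner (x 2) (\<rho> *v x 2)
    = cnj a * (ptrace_A \<rho> $ 1 $ 1 * a + ptrace_A \<rho> $ 1 $ 2 * b)
      + cnj b * (ptrace_A \<rho> $ 2 $ 1 * a + ptrace_A \<rho> $ 2 $ 2 * b)"
    by (simp add: cx mv ptrace_A_def sum_2 algebra_simps)
  also have "\<dots> = 0" by (simp add: kernel)
  finally have "qform \<rho> (x 1) + qform \<rho> (x 2) = 0"
    by (simp add: qform_def flip: plus_complex.sel)
  moreover have "qform \<rho> (x i) \<ge> 0" for i using psd by (simp add: psd_def)
  ultimately have "qform \<rho> (x i) = 0" for i
    using exhaust_2[of i] by (smt (verit))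
  then have "\<rho> *v x i = 0" for i by (rule psd_qform_eq_0[OF psd])
  then have "\<rho> $ (j, k) $ (i, 1) * a + \<rho> $ (j, k) $ (i, 2) * b = 0" for i j k
    by (metis mv zero_index)
  then show ?thesis by (simp add: vec_eq_iff mult.commute)
qed

text \<open>With unit trace, purity of the reduced state means that its determinant vanishes. Its
  kernel vectors give linear relations between the columns of blocks (\<open>b1\<close>,
  \<open>b2\<close>), conjugation gives those between the rows (\<open>b3\<close>,
  \<open>b4\<close>), and together they determine every block.\<close>

lemma pure_ptrace_A_product:
  fixes \<rho> :: cmat4
  assumes dm: "density_matrix \<rho>" and pure: "trace (ptrace_A \<rho> ** ptrace_A \<rho>) = 1"
  shows "block k l \<rho> = cscale (ptrace_A \<rho> $ k $ l) (block 1 1 \<rho> + block 2 2 \<rho>)"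
    and "ptrace_A \<rho> $ 1 $ 2 * ptrace_A \<rho> $ 2 $ 1 = ptrace_A \<rho> $ 1 $ 1 * ptrace_A \<rho> $ 2 $ 2"
proof -
  define B where "B = ptrace_A \<rho>"
  have psd: "psd \<rho>" using dm by (simp add: density_matrix_iff)
  have tr: "B $ 1 $ 1 + B $ 2 $ 2 = 1"
    using dm by (simp add: density_matrix_iff B_def ptrace_A_nth trace_eq_blocks)
  have "B $ 1 $ 1 * B $ 1 $ 1 + B $ 1 $ 2 * B $ 2 $ 1 + (B $ 2 $ 1 * B $ 1 $ 2 + B $ 2 $ 2 * B $ 2 $ 2) = 1"
    using pure by (simp add: B_def[symmetric] trace_2 matmul_2)
  \<comment> \<open>The difference between the purity equation and the square of
    \<open>tr\<close>.\<close>
  then have "2 * (B $ 1 $ 2 * B $ 2 $ 1) = 2 * (B $ 1 $ 1 * B $ 2 $ 2)"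
    using tr by algebra
  then have det: "B $ 1 $ 2 * B $ 2 $ 1 = B $ 1 $ 1 * B $ 2 $ 2" by simp
  then show "ptrace_A \<rho> $ 1 $ 2 * ptrace_A \<rho> $ 2 $ 1 = ptrace_A \<rho> $ 1 $ 1 * ptrace_A \<rho> $ 2 $ 2"
    by (simp add: B_def)
  have "cscale (B $ 1 $ 2) (block k 1 \<rho>) + cscale (- B $ 1 $ 1) (block k 2 \<rho>) = 0" for k
    by (rule kernel_ptrace_A[OF psd]) (use det in \<open>simp_all add: B_def mult.commute\<close>)
  then have b1: "B $ 1 $ 2 * \<rho> $ (i, k) $ (j, 1) = B $ 1 $ 1 * \<rho> $ (i, k) $ (j, 2)" for i k j
    by (simp add: vec_eq_iff)
  have "cscale (B $ 2 $ 2) (block k 1 \<rho>) + cscale (- B $ 2 $ 1) (block k 2 \<rho>) = 0" for k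
    by (rule kernel_ptrace_A[OF psd]) (use det in \<open>simp_all add: B_def mult.commute\<close>)
  then have b2: "B $ 2 $ 2 * \<rho> $ (i, k) $ (j, 1) = B $ 2 $ 1 * \<rho> $ (i, k) $ (j, 2)" for i k j
    by (simp add: vec_eq_iff)
  have herm: "\<rho> $ q $ p = cnj (\<rho> $ p $ q)" for p q
    using psd by (metis dagger_nth psd_def)
  have hermB: "cnj (B $ k $ l) = B $ l $ k" for k l
    by (simp add: B_def ptrace_A_def herm[of "(_, k)" "(_, l)"])
  have b3: "B $ 2 $ 1 * \<rho> $ (j, 1) $ (i, k) = B $ 1 $ 1 * \<rho> $ (j, 2) $ (i, k)" for j k i
    using arg_cong[OF b1[of i k j], of cnj] by (simp add: hermB flip: herm)
  have b4: "B $ 2 $ 2 * \<rho> $ (j, 1) $ (i, k) = B $ 1 $ 2 * \<rho> $ (j, 2) $ (i, k)" for j k i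
    using arg_cong[OF b2[of i k j], of cnj] by (simp add: hermB flip: herm)
  have "\<rho> $ (i, k) $ (j, l) = B $ k $ l * (\<rho> $ (i, 1) $ (j, 1) + \<rho> $ (i, 2) $ (j, 2))" for i j
  proof -
    \<comment> \<open>Unit trace splits an entry into two terms; in each, one of the relations
      \<open>b1\<close> to \<open>b5\<close> either brings out the factor \<open>B $ k $ l\<close>
      or finds it already there.\<close>
    have split: "x = B $ 1 $ 1 * x + B $ 2 $ 2 * x" for x
      by (metis distrib_right mult_1 tr)
    have b5: "B $ 2 $ 2 * \<rho> $ (i, 1) $ (j, 1) = B $ 1 $ 1 * \<rho> $ (i, 2) $ (j, 2)"
      using b4[of i j 1] b1[of i 2 j] by simp
    consider "k = 1" "l = 1" | "k = 1" "l = 2" | "k = 2" "l = 1" | "k = 2" "l = 2"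
      using exhaust_2[of k] exhaust_2[of l] by auto
    then show ?thesis
    proof cases
      case 1
      then show ?thesis by (simp only:) (rule trans[OF split], simp add: b5 distrib_left)
    next
      case 2
      then show ?thesis
        by (simp only:) (rule trans[OF split], simp add: b1[of i 1 j, symmetric] b4[of i j 2] distrib_left)
    next
      case 3
      then show ?thesis
        by (simp only:) (rule trans[OF split], simp add: b3[of i j 1, symmetric] b2[of i 2 j] distrib_left)
    next
      case 4
      then show ?thesis
        by (simp only:) (rule trans[OF split], simp add: b5[symmetric] distrib_left)
    qed
  qed
  then show "block k l \<rho> = cscale (ptrace_A \<rho> $ k $ l) (block 1 1 \<rho> + block 2 2 \<rho>)"
    by (simp add: vec_eq_iff B_def)
qed

section \<open>Dynamics under dispersive coupling\<close>

text \<open>Every point of a nondegenerate interval remains a limit point after finitely many points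
  are removed.\<close>

lemma eq_off_finite_imp_eq:
  fixes f :: "real \<Rightarrow> 'a::t2_space"
  assumes "a < b" and cont: "continuous_on {a..b} f" and S: "finite S"
    and eq: "\<And>t. t \<in> {a..b} - S \<Longrightarrow> f t = c" and t: "t \<in> {a..b}"
  shows "f t = c"
proof -
  have nontrivial: "at t within {a..b} \<noteq> bot"
    using assms by (simp add: trivial_limit_within islimpt_Icc)
  have "\<forall>\<^sub>F s in at t. s \<notin> S"
    using S islimpt_finite islimpt_iff_eventually by blast
  then have "\<forall>\<^sub>F s in at t within {a..b}. s \<notin> S"
    by (rule filter_leD[OF at_le[OF subset_UNIV]])
  then have "\<forall>\<^sub>F s in at t within {a..b}. f s = c"
    unfolding eventually_at_filter by eventually_elim (use eq in auto)
  then have lim_c: "(f \<longlongrightarrow> c) (at t within {a..b})" by (rule tendsto_eventually)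
  have lim_f: "(f \<longlongrightarrow> f t) (at t within {a..b})"
    using cont t by (simp add: continuous_on_def)
  show ?thesis by (rule tendsto_unique[OF nontrivial lim_f lim_c])
qed

text \<open>The fundamental theorem of calculus tolerates finitely many exceptions and writes
  \<open>f\<close> as an integral of \<open>f'\<close>; continuity of \<open>f'\<close> then makes
  that integral differentiable everywhere.\<close>

lemma has_vector_derivative_off_finite:
  fixes f :: "real \<Rightarrow> 'a::banach"
  assumes cont: "continuous_on {a..b} f" "continuous_on {a..b} f'" and S: "finite S"
    and der: "\<And>t. t \<in> {a..b} - S \<Longrightarrow> (f has_vector_derivative f' t) (at t within {a..b})"
    and t: "t \<in> {a..b}"
  shows "(f has_vector_derivative f' t) (at t within {a..b})"
proof -
  have f: "f s = f a + integral {a..s} f'" if s: "s \<in> {a..b}" for s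
  proof -
    have "(f' has_integral f s - f a) {a..s}"
    proof (rule fundamental_theorem_of_calculus_interior_strong[OF S])
      show "continuous_on {a..s} f" by (rule continuous_on_subset[OF cont(1)]) (use s in auto)
      fix r assume "r \<in> {a<..<s} - S"
      then have "r \<in> {a..b} - S" "r \<in> interior {a..b}" using s by auto
      then show "(f has_vector_derivative f' r) (at r)" using der by (metis at_within_interior)
    qed (use s in auto)
    then show ?thesis by (simp add: integral_unique)
  qed
  have "((\<lambda>s. f a + integral {a..s} f') has_vector_derivative f' t) (at t within {a..b})"
    using integral_has_vector_derivative[OF cont(2) t] by (auto intro!: derivative_eq_intros)
  then show ?thesis
    by - (rule has_vector_derivative_transform[OF t], rule f)
qed

text \<open>Unit trace eliminates \<open>w\<close> from the entries of \<open>eq\<close>, which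
  leave \<open>p * q = 0\<close>, \<open>p * a = 0\<close> and \<open>q * b = 0\<close> after
  division by \<open>g\<close>. As \<open>p\<close> and \<open>q\<close> are not both zero and
  \<open>b\<close> is conjugate to \<open>a\<close>, the off-diagonal entries vanish.\<close>

lemma dispersive_stationary:
  fixes A :: cmat2
  assumes g: "g \<noteq> 0" and tr: "trace A = 1" and herm: "dagger A = A"
    and eq: "cscale (trace ((g *\<^sub>R pauli 3 + w *\<^sub>R mat 1) ** A)) A = A ** (g *\<^sub>R pauli 3 + w *\<^sub>R mat 1)"
  shows "A $ 1 $ 2 = 0" and "A $ 2 $ 1 = 0" and "(A $ 1 $ 1 - A $ 2 $ 2)\<^sup>2 = 1"
proof -
  define a b p q where "a = A $ 1 $ 2" and "b = A $ 2 $ 1" and "p = A $ 1 $ 1" and "q = A $ 2 $ 2"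
  define G W where "G = complex_of_real g" and "W = complex_of_real w"
  have G: "G \<noteq> 0" using g by (simp add: G_def)
  have pq: "p + q = 1" using tr by (simp add: trace_2 p_def q_def)
  have ab: "b = cnj a" using arg_cong[OF herm, of "\<lambda>M. M $ 2 $ 1"] by (simp add: a_def b_def)
  define M where "M = g *\<^sub>R pauli 3 + w *\<^sub>R (mat 1 :: cmat2)"
  have M: "M $ 1 $ 1 = G + W" "M $ 1 $ 2 = 0" "M $ 2 $ 1 = 0" "M $ 2 $ 2 = W - G"
    by (simp_all add: M_def G_def W_def mat_def) (simp_all add: scaleR_conv_of_real)
  have entry: "cscale (trace (M ** A)) A $ i $ j = (A ** M) $ i $ j" for i j
    using eq by (simp only: M_def)
  have "((G + W) * p + (W - G) * q) * p = p * (G + W)"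
    using entry[of 1 1]
    by (simp add: trace_2 matmul_2 p_def q_def a_def b_def M)
  then have "G * (p * q) = 0" using pq by algebra
  then have "p * q = 0" using G by simp
  have "((G + W) * p + (W - G) * q) * a = a * (W - G)"
    using entry[of 1 2]
    by (simp add: trace_2 matmul_2 p_def q_def a_def b_def M)
  then have "G * (p * a) = 0" using pq by algebra
  then have pa: "p * a = 0" using G by simp
  have "((G + W) * p + (W - G) * q) * b = b * (G + W)"
    using entry[of 2 1]
    by (simp add: trace_2 matmul_2 p_def q_def a_def b_def M)
  then have "G * (q * b) = 0" using pq by algebra
  then have qb: "q * b = 0" using G by simp
  have "a = 0"
  proof (cases "p = 0")
    case True
    then show ?thesis using qb pq ab by simp
  qed (use pa in simp)
  then show "A $ 1 $ 2 = 0" "A $ 2 $ 1 = 0" using ab by (simp_all add: a_def b_def)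
  have "(p - q)\<^sup>2 = 1" using \<open>p * q = 0\<close> pq by algebra
  then show "(A $ 1 $ 1 - A $ 2 $ 2)\<^sup>2 = 1" by (simp add: p_def q_def)
qed

lemma master_solution_flow:
  "master_solution T H K \<l> u \<rho> \<longleftrightarrow> lindblad_flow T (\<lambda>t. H (u t)) K (\<lambda>k. \<l> k \<otimes>\<^sub>K mat 1) \<rho>"
  by (simp add: master_solution_def lindblad_flow_def master_rhs_def)

section \<open>Solutions starting in a density matrix\<close>

text \<open>The common setting of both halves of the theorem;
  \<open>pure_dispersive_solution\<close> adds the hypotheses of the first half.\<close>

locale dispersive_solution =
  fixes g \<omega>a \<omega>b :: real and H :: "real ^ 3 \<Rightarrow> cmat4" and K :: nat and \<l> :: "nat \<Rightarrow> cmat2"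
    and T :: real and u :: "real \<Rightarrow> real ^ 3" and \<rho> :: "real \<Rightarrow> cmat4"
  assumes H: "H = hamiltonian \<omega>a \<omega>b ((g / 2) *\<^sub>R (pauli 3 \<otimes>\<^sub>K pauli 3))"
    and T: "T > 0" and u: "piecewise_smooth T u" and sol: "master_solution T H K \<l> u \<rho>"
    and init: "density_matrix (\<rho> 0)"
begin

definition D :: cmat2 where "D = g *\<^sub>R pauli 3 + \<omega>b *\<^sub>R mat 1"

lemma density: "t \<in> {0..T} \<Longrightarrow> density_matrix (\<rho> t)"
proof (rule lindblad_flow_density_matrix)
  show "lindblad_flow T (\<lambda>t. H (u t)) K (\<lambda>k. \<l> k \<otimes>\<^sub>K mat 1) \<rho>"
    using sol by (simp add: master_solution_flow)
  show "dagger (H (u t)) = H (u t)" for t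
    unfolding H by (rule dagger_hamiltonian) (simp add: dagger_scaleR dagger_kron)
  show "bounded ((\<lambda>t. H (u t)) ` {0..T})"
    unfolding H by (rule bounded_hamiltonian[OF u])
qed (use init in auto)

definition block_rhs :: "real \<Rightarrow> 2 \<Rightarrow> 2 \<Rightarrow> cmat2"
  where "block_rhs t k l =
    cscale (- \<i>) (block_hamiltonian g \<omega>a \<omega>b (u t) k ** block k l (\<rho> t)
      - block k l (\<rho> t) ** block_hamiltonian g \<omega>a \<omega>b (u t) l)
    + lindblad K \<l> (block k l (\<rho> t))"

text \<open>One exceptional set is fixed by choice, so that all derivative facts below hold off the
  same finite set.\<close>

definition jumps :: "real set"
  where "jumps = (SOME S. finite S \<and> (\<forall>t\<in>{0..T} - S.
          (\<rho> has_vector_derivative master_rhs (H (u t)) K \<l> (\<rho> t)) (at t within {0..T})))"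

lemma jumps: "finite jumps"
    "t \<in> {0..T} - jumps \<Longrightarrow>
      (\<rho> has_vector_derivative master_rhs (H (u t)) K \<l> (\<rho> t)) (at t within {0..T})"
  using someI_ex[of "\<lambda>S. finite S \<and> (\<forall>t\<in>{0..T} - S.
          (\<rho> has_vector_derivative master_rhs (H (u t)) K \<l> (\<rho> t)) (at t within {0..T}))"] sol
  unfolding master_solution_def jumps_def[symmetric] by blast+

lemma continuous_linear: "linear f \<Longrightarrow> continuous_on {0..T} (\<lambda>t. f (\<rho> t))"
  for f :: "cmat4 \<Rightarrow> 'a::euclidean_space"
  using sol unfolding master_solution_def by (simp add: bounded_linear.continuous_on linear_linear)

lemma block_derivative:
  assumes "t \<in> {0..T} - jumps"
  shows "((\<lambda>s. block k l (\<rho> s)) has_vector_derivative block_rhs t k l) (at t within {0..T})"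
  using bounded_linear.has_vector_derivative[OF bounded_linear_block jumps(2)[OF assms]]
  by (simp add: block_rhs_def block_master_rhs[OF fun_cong[OF H]])

lemma linear_trace: "linear (trace :: cmat2 \<Rightarrow> complex)"
  by (rule linearI) (simp_all add: trace_add trace_scaleR)

lemma linear_ptrace_A: "linear (\<lambda>M :: cmat4. ptrace_A M $ k $ l)"
  using linear_compose[OF linear_block linear_trace] by (simp add: o_def ptrace_A_nth)

text \<open>The dissipator is traceless, and cyclicity merges the two products with the block
  Hamiltonians. For \<open>k = l\<close> nothing is left, so the populations of B are
  conserved.\<close>

lemma trace_block_rhs:
  "trace (block_rhs t k l) = - \<i> * trace ((block_hamiltonian g \<omega>a \<omega>b (u t) k
      - block_hamiltonian g \<omega>a \<omega>b (u t) l) ** block k l (\<rho> t))"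
  unfolding block_rhs_def trace_add trace_cscale trace_lindblad trace_sub
    trace_mul_sym[of "block k l (\<rho> t)"] linear_diff[OF linear_matmul_right] by simp

lemma ptrace_A_derivative:
  assumes "t \<in> {0..T} - jumps"
  shows "((\<lambda>s. ptrace_A (\<rho> s) $ k $ l) has_vector_derivative trace (block_rhs t k l)) (at t within {0..T})"
  unfolding ptrace_A_nth
  by (rule bounded_linear.has_vector_derivative[OF _ block_derivative[OF assms]])
    (simp add: linear_trace linear_linear)

lemma ptrace_A_diag_const:
  assumes t: "t \<in> {0..T}"
  shows "ptrace_A (\<rho> t) $ k $ k = ptrace_A (\<rho> 0) $ k $ k"
proof (rule has_derivative_zero_unique_strong_interval[OF jumps(1) _ refl _ t])
  show "continuous_on {0..T} (\<lambda>t. ptrace_A (\<rho> t) $ k $ k)"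
    by (rule continuous_linear[OF linear_ptrace_A])
  show "((\<lambda>t. ptrace_A (\<rho> t) $ k $ k) has_derivative (\<lambda>h. 0)) (at s within {0..T})"
    if "s \<in> {0..T} - jumps" for s
    using ptrace_A_derivative[OF that, of k k]
    by (simp add: trace_block_rhs linear_0[OF linear_matmul_right] linear_0[OF linear_trace]
        has_vector_derivative_def)
qed

lemma trace_ptrace_A:
  assumes t: "t \<in> {0..T}"
  shows "ptrace_A (\<rho> t) $ 1 $ 1 + ptrace_A (\<rho> t) $ 2 $ 2 = 1"
  using density[OF t] by (simp add: density_matrix_iff ptrace_A_nth trace_eq_blocks)

lemma ptrace_A_hermitian:
  assumes t: "t \<in> {0..T}"
  shows "ptrace_A (\<rho> t) $ k $ l = cnj (ptrace_A (\<rho> t) $ l $ k)"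
proof -
  have "ptrace_A (dagger M) = dagger (ptrace_A M)" for M :: cmat4
    by (simp add: vec_eq_iff ptrace_A_def)
  then show ?thesis
    using density[OF t] by (metis density_matrix_iff dagger_nth psd_def)
qed

end

section \<open>Coherences of B and the marginal state of A\<close>

context dispersive_solution
begin

lemma trace_block_rhs_12: "trace (block_rhs t 1 2) = - \<i> * trace (D ** block 1 2 (\<rho> t))"
  and trace_block_rhs_21: "trace (block_rhs t 2 1) = \<i> * trace (D ** block 2 1 (\<rho> t))"
proof -
  show "trace (block_rhs t 1 2) = - \<i> * trace (D ** block 1 2 (\<rho> t))"
    by (simp only: trace_block_rhs block_hamiltonian_diff D_def)
  have "block_hamiltonian g \<omega>a \<omega>b (u t) 2 - block_hamiltonian g \<omega>a \<omega>b (u t) 1 = - D"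
    by (simp only: D_def block_hamiltonian_diff[of g \<omega>a \<omega>b "u t", symmetric] minus_diff_eq)
  then show "trace (block_rhs t 2 1) = \<i> * trace (D ** block 2 1 (\<rho> t))"
    by (simp only: trace_block_rhs linear_neg[OF linear_matmul_right] linear_neg[OF linear_trace]) simp
qed

text \<open>This is the partial trace of \<open>\<rho>\<close> over B.\<close>

definition rhoA :: "real \<Rightarrow> cmat2" where "rhoA t = block 1 1 (\<rho> t) + block 2 2 (\<rho> t)"

lemma rhoA_trace: "t \<in> {0..T} \<Longrightarrow> trace (rhoA t) = 1"
  using density by (simp add: rhoA_def trace_add trace_eq_blocks density_matrix_iff)

lemma rhoA_hermitian:
  assumes "t \<in> {0..T}"
  shows "dagger (rhoA t) = rhoA t"
proof -
  have "dagger (block k k M) = block k k (dagger M)" for k and M :: cmat4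
    by (simp add: vec_eq_iff)
  then show ?thesis
    using density[OF assms] by (simp add: rhoA_def dagger_add density_matrix_iff psd_def)
qed

lemma v_A_rhoA:
  "v_A (\<rho> t) $ 1 = (rhoA t $ 1 $ 2 + rhoA t $ 2 $ 1) / 2"
  "v_A (\<rho> t) $ 2 = \<i> * (rhoA t $ 1 $ 2 - rhoA t $ 2 $ 1) / 2"
  "v_A (\<rho> t) $ 3 = (rhoA t $ 1 $ 1 - rhoA t $ 2 $ 2) / 2"
  by (simp_all add: v_A_nth[OF rhoA_def] trace_2 matmul_2 algebra_simps)

lemma linear_v_A: "linear (\<lambda>M. v_A M $ i)"
  unfolding v_A_def
  by (rule linearI) (simp_all add: trace_add trace_scaleR linear_add[OF linear_matmul_right]
      linear_scale[OF linear_matmul_right] distrib_left)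

text \<open>For \<open>A\<close> of unit trace this is \<open>\<omega>b + 2 g v\<^sub>3\<close>,
  with \<open>v\<^sub>3\<close> the third Bloch component of \<open>A\<close>: the rate at which the
  coherences of B rotate.\<close>

lemma trace_D: "trace (D ** A) = of_real g * (A $ 1 $ 1 - A $ 2 $ 2) + of_real \<omega>b * trace A"
proof -
  have entries: "D $ 1 $ 1 = of_real g + of_real \<omega>b" "D $ 1 $ 2 = 0" "D $ 2 $ 1 = 0"
    "D $ 2 $ 2 = of_real \<omega>b - of_real g"
    by (simp_all add: D_def mat_def) (simp_all add: scaleR_conv_of_real)
  show ?thesis by (simp add: trace_2 matmul_2 entries) (simp add: algebra_simps)
qed

end

section \<open>Solutions whose reduced state of B stays pure\<close>

locale pure_dispersive_solution = dispersive_solution +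
  assumes g: "g \<noteq> 0"
    and pure: "\<And>t. t \<in> {0..T} \<Longrightarrow> trace (ptrace_A (\<rho> t) ** ptrace_A (\<rho> t)) = 1"
begin

lemma block_eq: "t \<in> {0..T} \<Longrightarrow> block k l (\<rho> t) = cscale (ptrace_A (\<rho> t) $ k $ l) (rhoA t)"
  and ptrace_A_det: "t \<in> {0..T} \<Longrightarrow> ptrace_A (\<rho> t) $ 1 $ 2 * ptrace_A (\<rho> t) $ 2 $ 1
    = ptrace_A (\<rho> t) $ 1 $ 1 * ptrace_A (\<rho> t) $ 2 $ 2"
  using pure_ptrace_A_product[OF density pure] unfolding rhoA_def by blast+

text \<open>
  Comparing the derivatives of \<open>B\<^sub>1\<^sub>2 R\<^sub>1\<^sub>1\<close> and \<open>B\<^sub>1\<^sub>1 R\<^sub>1\<^sub>2\<close>, which are equal when \<open>\<rho>\<close> is a product,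
  removes the control and the dissipation.
\<close>

lemma stationary_off_jumps:
  assumes t: "t \<in> {0..T} - jumps"
    and nz: "ptrace_A (\<rho> 0) $ 1 $ 1 \<noteq> 0" "ptrace_A (\<rho> 0) $ 2 $ 2 \<noteq> 0"
  shows "v_A (\<rho> t) $ 1 = 0" and "v_A (\<rho> t) $ 2 = 0" and "(v_A (\<rho> t) $ 3)\<^sup>2 = 1/4"
proof -
  define c where "c = ptrace_A (\<rho> 0) $ 1 $ 1"
  define h1 h2 where "h1 = block_hamiltonian g \<omega>a \<omega>b (u t) 1" and "h2 = block_hamiltonian g \<omega>a \<omega>b (u t) 2"
  define b where "b = ptrace_A (\<rho> t) $ 1 $ 2"
  define b' where "b' = trace (block_rhs t 1 2)"
  define A where "A = rhoA t"
  define LA where "LA = lindblad K \<l> A"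
  have tT: "t \<in> {0..T}" using t by simp
  have B11: "ptrace_A (\<rho> s) $ 1 $ 1 = c" if "s \<in> {0..T}" for s
    unfolding c_def by (rule ptrace_A_diag_const[OF that])
  \<comment> \<open>The off-diagonal product equals the product of the diagonal entries, which are
    constant and nonzero.\<close>
  have "b * ptrace_A (\<rho> t) $ 2 $ 1 \<noteq> 0"
    unfolding b_def ptrace_A_det[OF tT] using nz ptrace_A_diag_const[OF tT] by simp
  then have b: "b \<noteq> 0" by auto
  have c: "c \<noteq> 0" using nz by (simp add: c_def)
  have R: "block 1 1 (\<rho> t) = cscale c A" "block 1 2 (\<rho> t) = cscale b A"
    unfolding block_eq[OF tT] using B11[OF tT] by (simp_all add: A_def b_def)
  have rhs: "block_rhs t 1 1 = cscale c (cscale (- \<i>) (h1 ** A - A ** h1) + LA)"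
    "block_rhs t 1 2 = cscale b (cscale (- \<i>) (h1 ** A - A ** h2) + LA)"
    unfolding block_rhs_def R h1_def[symmetric] h2_def[symmetric] lindblad_cscale LA_def[symmetric]
      cscale_mult_left cscale_mult_right
    by (simp_all add: vec_eq_iff algebra_simps)
  have entry: "((\<lambda>s. block 1 m (\<rho> s) $ i $ j) has_vector_derivative block_rhs t 1 m $ i $ j)
      (at t within {0..T})" for m i j
    using bounded_linear.has_vector_derivative[OF bounded_linear_vec_nth
        bounded_linear.has_vector_derivative[OF bounded_linear_vec_nth block_derivative[OF t]]] .
  have "b * block_rhs t 1 1 $ i $ j + b' * (c * A $ i $ j) = c * block_rhs t 1 2 $ i $ j" for i j
  proof -
    have "((\<lambda>s. ptrace_A (\<rho> s) $ 1 $ 2 * block 1 1 (\<rho> s) $ i $ j) has_vector_derivative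
        b * block_rhs t 1 1 $ i $ j + b' * block 1 1 (\<rho> t) $ i $ j) (at t within {0..T})"
      unfolding b_def b'_def by (rule has_vector_derivative_mult[OF ptrace_A_derivative[OF t] entry])
    then have 1: "((\<lambda>s. c * block 1 2 (\<rho> s) $ i $ j) has_vector_derivative
        b * block_rhs t 1 1 $ i $ j + b' * (c * A $ i $ j)) (at t within {0..T})"
      unfolding R(1) cscale_nth
      by - (rule has_vector_derivative_transform[OF tT],
          simp_all only: block_eq B11 cscale_nth mult.left_commute)
    have 2: "((\<lambda>s. c * block 1 2 (\<rho> s) $ i $ j) has_vector_derivative c * block_rhs t 1 2 $ i $ j)
        (at t within {0..T})"
      by (rule has_vector_derivative_mult_right[OF entry])
    show ?thesis
      using vector_derivative_unique_within_closed_interval[of 0 T t, unfolded cbox_interval, OF T tT 1 2] .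
  qed
  \<comment> \<open>The terms with \<open>LA\<close> and with \<open>h1 ** A\<close> agree on both
    sides, which leaves \<open>A ** (h1 - h2)\<close>, that is, \<open>A ** D\<close>.\<close>
  then have "c * (b' * A $ i $ j) = c * (- \<i> * b * (A ** D) $ i $ j)" for i j
    unfolding rhs D_def block_hamiltonian_diff[of g \<omega>a \<omega>b "u t", symmetric] h1_def[symmetric] h2_def[symmetric]
      linear_diff[OF linear_matmul_left]
    by (simp add: algebra_simps)
  then have 1: "b' * A $ i $ j = - \<i> * b * (A ** D) $ i $ j" for i j
    by (rule mult_left_cancel[OF c, THEN iffD1])
  have b': "b' = - \<i> * b * trace (D ** A)"
    unfolding b'_def trace_block_rhs_12 R(2) cscale_mult_right trace_cscale by simp
  have "- \<i> * b * (trace (D ** A) * A $ i $ j) = - \<i> * b * (A ** D) $ i $ j" for i j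
    using 1[of i j] unfolding b' by (simp add: mult.assoc)
  then have "trace (D ** A) * A $ i $ j = (A ** D) $ i $ j" for i j
    using b by simp
  then have "cscale (trace (D ** A)) A = A ** D" by (simp add: vec_eq_iff)
  note st = dispersive_stationary[OF g rhoA_trace[OF tT] rhoA_hermitian[OF tT]
      this[unfolded D_def A_def]]
  show "v_A (\<rho> t) $ 1 = 0" "v_A (\<rho> t) $ 2 = 0" by (simp_all add: v_A_rhoA st)
  show "(v_A (\<rho> t) $ 3)\<^sup>2 = 1/4" by (simp add: v_A_rhoA power_divide st)
qed

text \<open>The diagonal of the reduced state is conserved, so time 0 decides the case. A zero
  diagonal entry kills the coherences through the determinant and puts B at a pole; otherwise A is
  at a pole off the jumps, and by continuity always.\<close>

lemma pole_A_or_pole_B: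
  "(\<forall>t\<in>{0..T}. (v_B (\<rho> t) $ 3)\<^sup>2 = 1/4 \<and> v_B (\<rho> t) $ 1 = 0 \<and> v_B (\<rho> t) $ 2 = 0) \<or>
   (\<forall>t\<in>{0..T}. (v_A (\<rho> t) $ 3)\<^sup>2 = 1/4 \<and> v_A (\<rho> t) $ 1 = 0 \<and> v_A (\<rho> t) $ 2 = 0)"
proof (cases "ptrace_A (\<rho> 0) $ 1 $ 1 = 0 \<or> ptrace_A (\<rho> 0) $ 2 $ 2 = 0")
  case True
  have "(v_B (\<rho> t) $ 3)\<^sup>2 = 1/4 \<and> v_B (\<rho> t) $ 1 = 0 \<and> v_B (\<rho> t) $ 2 = 0" if t: "t \<in> {0..T}" for t
  proof -
    have z: "ptrace_A (\<rho> t) $ 1 $ 1 = 0 \<or> ptrace_A (\<rho> t) $ 2 $ 2 = 0"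
      using True by (simp add: ptrace_A_diag_const[OF t])
    then have "ptrace_A (\<rho> t) $ 1 $ 2 * ptrace_A (\<rho> t) $ 2 $ 1 = 0"
      unfolding ptrace_A_det[OF t] by auto
    then have "ptrace_A (\<rho> t) $ 1 $ 2 = 0" "ptrace_A (\<rho> t) $ 2 $ 1 = 0"
      using ptrace_A_hermitian[OF t, of 1 2] by auto
    moreover have "(ptrace_A (\<rho> t) $ 1 $ 1 - ptrace_A (\<rho> t) $ 2 $ 2)\<^sup>2 = 1"
      using z trace_ptrace_A[OF t] by (elim disjE) simp_all
    ultimately show ?thesis by (simp add: v_B_nth power_divide)
  qed
  then show ?thesis by blast
next
  case False
  then have nz: "ptrace_A (\<rho> 0) $ 1 $ 1 \<noteq> 0" "ptrace_A (\<rho> 0) $ 2 $ 2 \<noteq> 0" by auto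
  note extend = eq_off_finite_imp_eq[OF T _ jumps(1)]
  note cont = continuous_linear[OF linear_v_A]
  have "v_A (\<rho> t) $ 1 = 0" if t: "t \<in> {0..T}" for t
    by (rule extend[of "\<lambda>t. v_A (\<rho> t) $ 1", OF cont stationary_off_jumps(1)[OF _ nz] t])
  moreover have "v_A (\<rho> t) $ 2 = 0" if t: "t \<in> {0..T}" for t
    by (rule extend[of "\<lambda>t. v_A (\<rho> t) $ 2", OF cont stationary_off_jumps(2)[OF _ nz] t])
  moreover have "(v_A (\<rho> t) $ 3)\<^sup>2 = 1/4" if t: "t \<in> {0..T}" for t
    by (rule extend[of "\<lambda>t. (v_A (\<rho> t) $ 3)\<^sup>2",
          OF continuous_on_power[OF cont] stationary_off_jumps(3)[OF _ nz] t])
  ultimately show ?thesis by blast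
qed

text \<open>The pole cannot change with time because the diagonal is conserved.\<close>

lemma pole_B_const:
  assumes a: "\<forall>t\<in>{0..T}. (v_B (\<rho> t) $ 3)\<^sup>2 = 1/4 \<and> v_B (\<rho> t) $ 1 = 0 \<and> v_B (\<rho> t) $ 2 = 0"
  shows "(\<forall>t\<in>{0..T}. ptrace_A (\<rho> t) = (1/2) *\<^sub>R (mat 1 + pauli 3)) \<or>
         (\<forall>t\<in>{0..T}. ptrace_A (\<rho> t) = (1/2) *\<^sub>R (mat 1 - pauli 3))"
proof -
  define B where "B t = ptrace_A (\<rho> t)" for t
  have off: "B t $ 1 $ 2 = 0" "B t $ 2 $ 1 = 0" if "t \<in> {0..T}" for t
    using a that by (force simp: v_B_nth B_def)+
  have tr: "B t $ 1 $ 1 + B t $ 2 $ 2 = 1" if "t \<in> {0..T}" for t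
    using trace_ptrace_A[OF that] by (simp add: B_def)
  have const: "B t $ k $ k = B 0 $ k $ k" if "t \<in> {0..T}" for t k
    using ptrace_A_diag_const[OF that] by (simp add: B_def)
  have half: "(1 / 2) *\<^sub>R (2 :: complex) = 1" by (simp add: scaleR_conv_of_real)
  have T0: "0 \<in> {0..T}" using T by simp
  have "((B 0 $ 1 $ 1 - B 0 $ 2 $ 2) / 2)\<^sup>2 = 1/4"
    using a T0 by (simp add: v_B_nth B_def)
  then have "B 0 $ 1 $ 1 * B 0 $ 2 $ 2 = 0"
    using tr[OF T0] by (simp add: power_divide) algebra
  then have "B 0 $ 1 $ 1 = 1 \<and> B 0 $ 2 $ 2 = 0 \<or> B 0 $ 1 $ 1 = 0 \<and> B 0 $ 2 $ 2 = 1"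
    using tr[OF T0] by auto
  then show ?thesis
  proof (elim disjE conjE)
    assume "B 0 $ 1 $ 1 = 1" "B 0 $ 2 $ 2 = 0"
    then have "B t = (1/2) *\<^sub>R (mat 1 + pauli 3)" if "t \<in> {0..T}" for t
      using const[OF that, of 1] const[OF that, of 2] off[OF that]
      by (simp add: vec_eq_iff forall_2 mat_def half)
    then show ?thesis by (simp add: B_def)
  next
    assume "B 0 $ 1 $ 1 = 0" "B 0 $ 2 $ 2 = 1"
    then have "B t = (1/2) *\<^sub>R (mat 1 - pauli 3)" if "t \<in> {0..T}" for t
      using const[OF that, of 1] const[OF that, of 2] off[OF that]
      by (simp add: vec_eq_iff forall_2 mat_def half)
    then show ?thesis by (simp add: B_def)
  qed
qed

end

section \<open>Dissipation balance at a pole of A and the Bloch equation of B\<close>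

context pure_dispersive_solution
begin

text \<open>A state resting at a pole has zero velocity along \<open>pauli 3\<close>. The commutator
  has no component in that direction, so the dissipator's component must vanish by itself.\<close>

lemma pole_A_dissipation_balance:
  assumes b: "\<forall>t\<in>{0..T}. (v_A (\<rho> t) $ 3)\<^sup>2 = 1/4 \<and> v_A (\<rho> t) $ 1 = 0 \<and> v_A (\<rho> t) $ 2 = 0"
    and t: "t \<in> {0..T}"
  shows "v_0 K \<l> $ 3 / 2 + v_A (\<rho> t) $ 3 * d_hat K \<l> $ 3 $ 3 = 0"
proof -
  \<comment> \<open>A continuous function with finite range on an interval is constant, so A cannot
    switch poles.\<close>
  have "(\<lambda>s. v_A (\<rho> s) $ 3) ` {0..T} \<subseteq> {1/2, - 1/2}"
  proof
    fix z assume "z \<in> (\<lambda>s. v_A (\<rho> s) $ 3) ` {0..T}"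
    then have "z\<^sup>2 = (1/2)\<^sup>2" using b by (auto simp: power_divide)
    then show "z \<in> {1/2, - 1/2}" unfolding power2_eq_iff by auto
  qed
  then have "finite ((\<lambda>s. v_A (\<rho> s) $ 3) ` {0..T})" by (rule finite_subset) simp
  then have "(\<lambda>s. v_A (\<rho> s) $ 3) constant_on {0..T}"
    by (intro continuous_finite_range_constant continuous_linear[OF linear_v_A]) auto
  then obtain \<alpha> where \<alpha>: "\<And>s. s \<in> {0..T} \<Longrightarrow> v_A (\<rho> s) $ 3 = \<alpha>"
    unfolding constant_on_def by blast
  \<comment> \<open>A single time of differentiability suffices: the balance contains only
    \<open>\<alpha>\<close> and constants of the dissipation.\<close>
  have "infinite ({0..T} - jumps)"
    using jumps(1) T by (simp add: infinite_Icc)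
  then obtain r where r: "r \<in> {0..T} - jumps"
    by (metis ex_in_conv finite.emptyI)
  then have rT: "r \<in> {0..T}" by simp
  have "rhoA r $ 1 $ 2 + rhoA r $ 2 $ 1 = 0" "rhoA r $ 1 $ 2 - rhoA r $ 2 $ 1 = 0"
    using b rT by (force simp: v_A_rhoA)+
  then have off: "rhoA r $ 1 $ 2 = 0" "rhoA r $ 2 $ 1 = 0" by auto
  have "rhoA r $ 1 $ 1 + rhoA r $ 2 $ 2 = 1" "rhoA r $ 1 $ 1 - rhoA r $ 2 $ 2 = 2 * \<alpha>"
    using rhoA_trace[OF rT] \<alpha>[OF rT] by (auto simp: trace_2 v_A_rhoA)
  then have "2 * rhoA r $ 1 $ 1 = 1 + 2 * \<alpha>" "2 * rhoA r $ 2 $ 2 = 1 - 2 * \<alpha>"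
    by algebra+
  then have "rhoA r $ 1 $ 1 = 1 / 2 + \<alpha>" "rhoA r $ 2 $ 2 = 1 / 2 - \<alpha>"
    by (auto simp: field_simps)
  then have rhoA: "rhoA r = (1/2) *\<^sub>R mat 1 + cscale \<alpha> (pauli 3)"
    using off by (simp add: vec_eq_iff forall_2 mat_def) (simp add: scaleR_conv_of_real)
  define \<phi> where "\<phi> M = trace (pauli 3 ** M)" for M :: cmat2
  have \<phi>: "linear \<phi>"
    unfolding \<phi>_def using linear_compose[OF linear_matmul_left linear_trace] by (simp add: o_def)
  have "((\<lambda>s. rhoA s) has_vector_derivative block_rhs r 1 1 + block_rhs r 2 2) (at r within {0..T})"
    unfolding rhoA_def by (intro has_vector_derivative_add block_derivative r)
  then have "((\<lambda>s. \<phi> (rhoA s)) has_vector_derivative \<phi> (block_rhs r 1 1 + block_rhs r 2 2)) (at r within {0..T})"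
    by (rule bounded_linear.has_vector_derivative[rotated]) (simp add: \<phi> linear_linear)
  then have 1: "((\<lambda>s. 2 * \<alpha>) has_vector_derivative \<phi> (block_rhs r 1 1 + block_rhs r 2 2)) (at r within {0..T})"
  proof (rule has_vector_derivative_transform[OF rT, rotated])
    show "2 * \<alpha> = \<phi> (rhoA s)" if "s \<in> {0..T}" for s
      using \<alpha>[OF that] by (auto simp: \<phi>_def v_A_nth[OF rhoA_def])
  qed
  have "\<phi> (block_rhs r 1 1 + block_rhs r 2 2) = 0"
    by (rule vector_derivative_unique_within_closed_interval[of 0 T r, unfolded cbox_interval, OF T rT 1])
      (rule has_vector_derivative_const)
  moreover have "\<phi> (block_rhs r k k) = \<phi> (lindblad K \<l> (block k k (\<rho> r)))" for k
  proof -
    \<comment> \<open>The block is diagonal and so commutes with \<open>pauli 3\<close>; cyclicity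
      then removes the commutator under \<open>\<phi>\<close>.\<close>
    have "block k k (\<rho> r) $ 1 $ 2 = 0" "block k k (\<rho> r) $ 2 $ 1 = 0"
      by (simp_all add: block_eq[OF rT] off del: block_nth)
    then have "\<phi> (cscale (- \<i>) (h ** block k k (\<rho> r) - block k k (\<rho> r) ** h)) = 0" for h
      by (simp add: \<phi>_def trace_2 matmul_2 del: block_nth)
    then show ?thesis by (simp add: block_rhs_def linear_add[OF \<phi>])
  qed
  ultimately have "\<phi> (lindblad K \<l> (rhoA r)) = 0"
    by (simp add: linear_add[OF \<phi>] rhoA_def linear_add[OF linear_lindblad])
  moreover have "\<phi> (lindblad K \<l> (rhoA r))
      = (1/2) * trace (pauli 3 ** lindblad K \<l> (mat 1)) + \<alpha> * trace (pauli 3 ** lindblad K \<l> (pauli 3))"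
    unfolding rhoA linear_add[OF linear_lindblad] linear_scale[OF linear_lindblad] lindblad_cscale
      linear_add[OF \<phi>] linear_scale[OF \<phi>]
    by (simp add: \<phi>_def cscale_mult_right trace_cscale) (simp add: scaleR_conv_of_real)
  ultimately have "(1/2) * trace (pauli 3 ** lindblad K \<l> (mat 1)) + \<alpha> * trace (pauli 3 ** lindblad K \<l> (pauli 3)) = 0"
    by simp
  then show ?thesis
    unfolding v_0_def d_hat_def \<alpha>[OF t] by (simp add: field_simps)
qed

lemma linear_v_B: "linear (\<lambda>M. v_B M $ i)"
  unfolding v_B_def
  by (rule linearI) (simp_all add: trace_add trace_scaleR linear_add[OF linear_matmul_right]
      linear_scale[OF linear_matmul_right] distrib_left)

text \<open>Since the blocks are multiples of \<open>rhoA\<close>, the coherences of B rotate at the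
  rate \<open>w\<close>. The right-hand sides are continuous and free of the control, so the
  equations also extend to the exceptional times.\<close>

lemma v_B_derivative:
  assumes t: "t \<in> {0..T}"
  shows "((\<lambda>s. v_B (\<rho> s) $ 1) has_vector_derivative
      - (of_real \<omega>b + 2 * of_real g * v_A (\<rho> t) $ 3) * v_B (\<rho> t) $ 2) (at t within {0..T})"
    and "((\<lambda>s. v_B (\<rho> s) $ 2) has_vector_derivative
      (of_real \<omega>b + 2 * of_real g * v_A (\<rho> t) $ 3) * v_B (\<rho> t) $ 1) (at t within {0..T})"
    and "((\<lambda>s. v_B (\<rho> s) $ 3) has_vector_derivative 0) (at t within {0..T})"
proof -
  define w where "w s = of_real \<omega>b + 2 * of_real g * v_A (\<rho> s) $ 3" for s
  note cont = continuous_linear[OF linear_v_B] continuous_linear[OF linear_v_A]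
  have D: "trace (D ** block k l (\<rho> s)) = ptrace_A (\<rho> s) $ k $ l * w s" if "s \<in> {0..T}" for k l s
    unfolding block_eq[OF that] cscale_mult_right trace_cscale
    by (simp add: trace_D rhoA_trace[OF that] w_def v_A_rhoA)
  have der: "((\<lambda>r. ptrace_A (\<rho> r) $ 1 $ 2) has_vector_derivative - \<i> * (ptrace_A (\<rho> s) $ 1 $ 2 * w s)) (at s within {0..T})"
    "((\<lambda>r. ptrace_A (\<rho> r) $ 2 $ 1) has_vector_derivative \<i> * (ptrace_A (\<rho> s) $ 2 $ 1 * w s)) (at s within {0..T})"
    if s: "s \<in> {0..T} - jumps" for s
    using ptrace_A_derivative[OF s, of 1 2] ptrace_A_derivative[OF s, of 2 1] s
    by (simp_all add: trace_block_rhs_12 trace_block_rhs_21 D)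
  show "((\<lambda>s. v_B (\<rho> s) $ 1) has_vector_derivative
      - (of_real \<omega>b + 2 * of_real g * v_A (\<rho> t) $ 3) * v_B (\<rho> t) $ 2) (at t within {0..T})"
  proof (rule has_vector_derivative_off_finite[OF _ _ jumps(1) _ t])
    fix s assume s: "s \<in> {0..T} - jumps"
    have "((\<lambda>r. (ptrace_A (\<rho> r) $ 1 $ 2 + ptrace_A (\<rho> r) $ 2 $ 1) / 2) has_vector_derivative
      (- \<i> * (ptrace_A (\<rho> s) $ 1 $ 2 * w s) + \<i> * (ptrace_A (\<rho> s) $ 2 $ 1 * w s)) / 2) (at s within {0..T})"
      by (intro bounded_linear.has_vector_derivative[OF bounded_linear_divide]
          has_vector_derivative_add der s)
    also have "(- \<i> * (ptrace_A (\<rho> s) $ 1 $ 2 * w s) + \<i> * (ptrace_A (\<rho> s) $ 2 $ 1 * w s)) / 2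
      = - w s * v_B (\<rho> s) $ 2"
      by (simp add: v_B_nth(2) field_simps)
    finally show "((\<lambda>s. v_B (\<rho> s) $ 1) has_vector_derivative
      - (of_real \<omega>b + 2 * of_real g * v_A (\<rho> s) $ 3) * v_B (\<rho> s) $ 2) (at s within {0..T})"
      unfolding v_B_nth(1) w_def .
  qed (intro continuous_intros cont)+
  show "((\<lambda>s. v_B (\<rho> s) $ 2) has_vector_derivative
      (of_real \<omega>b + 2 * of_real g * v_A (\<rho> t) $ 3) * v_B (\<rho> t) $ 1) (at t within {0..T})"
  proof (rule has_vector_derivative_off_finite[OF _ _ jumps(1) _ t])
    fix s assume s: "s \<in> {0..T} - jumps"
    have "((\<lambda>r. \<i> * (ptrace_A (\<rho> r) $ 1 $ 2 - ptrace_A (\<rho> r) $ 2 $ 1) / 2) has_vector_derivative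
      \<i> * (- \<i> * (ptrace_A (\<rho> s) $ 1 $ 2 * w s) - \<i> * (ptrace_A (\<rho> s) $ 2 $ 1 * w s)) / 2) (at s within {0..T})"
      by (intro bounded_linear.has_vector_derivative[OF bounded_linear_divide]
          has_vector_derivative_mult_right has_vector_derivative_diff der s)
    also have "\<i> * (- \<i> * (ptrace_A (\<rho> s) $ 1 $ 2 * w s) - \<i> * (ptrace_A (\<rho> s) $ 2 $ 1 * w s)) / 2
      = w s * v_B (\<rho> s) $ 1"
      by (simp add: v_B_nth(1) field_simps)
    finally show "((\<lambda>s. v_B (\<rho> s) $ 2) has_vector_derivative
      (of_real \<omega>b + 2 * of_real g * v_A (\<rho> s) $ 3) * v_B (\<rho> s) $ 1) (at s within {0..T})"
      unfolding v_B_nth(2) w_def .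
  qed (intro continuous_intros cont)+
  have "((\<lambda>s. (ptrace_A (\<rho> 0) $ 1 $ 1 - ptrace_A (\<rho> 0) $ 2 $ 2) / 2) has_vector_derivative 0) (at t within {0..T})"
    by (rule has_vector_derivative_const)
  then show "((\<lambda>s. v_B (\<rho> s) $ 3) has_vector_derivative 0) (at t within {0..T})"
    by - (rule has_vector_derivative_transform[OF t],
        simp_all only: v_B_nth(3) ptrace_A_diag_const[of _ 1] ptrace_A_diag_const[of _ 2])
qed

end

section \<open>Invariance of the sets with B at a pole\<close>

text \<open>\<open>P\<close> projects onto basis vector \<open>m\<close> of B, so the form only sees
  the slice of \<open>x\<close> at \<open>m\<close>. This makes the initial product states
  admissible for \<open>dispersive_solution\<close>.\<close>

lemma density_matrix_kron_projection:
  fixes \<rho>\<^sub>A P :: cmat2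
  assumes P: "\<And>k l. P $ k $ l = (if k = m \<and> l = m then 1 else 0)" and \<rho>\<^sub>A: "density_matrix \<rho>\<^sub>A"
  shows "density_matrix (\<rho>\<^sub>A \<otimes>\<^sub>K P)"
proof -
  have "dagger P = P" by (auto simp: vec_eq_iff P)
  moreover have "qform (\<rho>\<^sub>A \<otimes>\<^sub>K P) x = qform \<rho>\<^sub>A (\<chi> i. x $ (i, m))" for x
    using exhaust_2[of m]
    by (auto simp: qform_def cinner_def matrix_vector_mult_def sum_UNIV_pair sum_2 P)
  moreover have "trace (\<rho>\<^sub>A \<otimes>\<^sub>K P) = trace \<rho>\<^sub>A"
    using exhaust_2[of m] by (auto simp: trace_def sum_UNIV_pair sum_2 P)
  ultimately show ?thesis
    using \<rho>\<^sub>A by (simp add: density_matrix_iff psd_def dagger_kron)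
qed

text \<open>A diagonal block of zero trace has zero diagonal entries by positivity, and a zero
  diagonal entry forces its whole column, hence its row, to vanish. Only block \<open>m\<close>
  survives.\<close>

lemma density_matrix_eq_kron_projection:
  fixes M :: cmat4
  assumes P: "\<And>k l. P $ k $ l = (if k = m \<and> l = m then 1 else 0)"
    and M: "density_matrix M" and zero: "\<And>n. n \<noteq> m \<Longrightarrow> trace (block n n M) = 0"
  shows "M = block m m M \<otimes>\<^sub>K P" and "density_matrix (block m m M)"
proof -
  have psd: "psd M" using M by (simp add: density_matrix_iff)
  have herm: "M $ p $ q = cnj (M $ q $ p)" for p q
    using psd by (metis dagger_nth psd_def)
  have mv: "M *v axis q 1 = (\<chi> p. M $ p $ q)" for q
    by (simp add: vec_eq_iff matrix_vector_mult_def axis_def if_distrib cong: if_cong)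
  have q: "qform M (axis q 1) = Re (M $ q $ q)" for q
    unfolding qform_def mv by (simp add: cinner_def axis_def if_distrib if_distribR cong: if_cong)
  have col: "M $ p $ (i, n) = 0" if "n \<noteq> m" for p i n
  proof -
    have "Re (M $ (1, n) $ (1, n)) + Re (M $ (2, n) $ (2, n)) = 0"
      using arg_cong[OF zero[OF that], of Re] by (simp add: trace_2)
    moreover have "Re (M $ (j, n) $ (j, n)) \<ge> 0" for j
      using psd by (simp add: psd_def flip: q)
    ultimately have "Re (M $ (i, n) $ (i, n)) = 0"
      using exhaust_2[of i] by (smt (verit))
    then have "M *v axis (i, n) 1 = 0" by (intro psd_qform_eq_0[OF psd]) (simp only: q)
    then have "(M *v axis (i, n) 1) $ p = 0" by simp
    then show ?thesis by (simp add: mv)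
  qed
  have row: "M $ (i, n) $ p = 0" if "n \<noteq> m" for p i n
    using herm[of "(i, n)" p] col[OF that] by simp
  show "M = block m m M \<otimes>\<^sub>K P"
    unfolding vec_eq_iff split_paired_All
  proof (intro allI)
    show "M $ (i, k) $ (j, l) = (block m m M \<otimes>\<^sub>K P) $ (i, k) $ (j, l)" for i j k l
      using row[of k] col[of l] by (auto simp: P)
  qed
  have "dagger (block m m M) = block m m (dagger M)" by (simp add: vec_eq_iff)
  moreover have "qform (block m m M) x = qform M (\<chi> p. if snd p = m then x $ fst p else 0)" for x
    using exhaust_2[of m]
    by (auto simp: qform_def cinner_def matrix_vector_mult_def sum_UNIV_pair sum_2)
  moreover have "trace (block m m M) = trace M"
    using exhaust_2[of m] zero[of 1] zero[of 2] by (auto simp: trace_eq_blocks)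
  ultimately show "density_matrix (block m m M)"
    using M by (simp add: density_matrix_iff psd_def)
qed

text \<open>Populations of B are conserved, so the initially empty level stays empty, and positivity
  restores the product form.\<close>

lemma (in dispersive_solution) projection_invariant:
  fixes P :: cmat2
  assumes P: "\<And>k l. P $ k $ l = (if k = m \<and> l = m then 1 else 0)"
    and \<rho>0: "\<rho> 0 = \<rho>\<^sub>A \<otimes>\<^sub>K P" and t: "t \<in> {0..T}"
  shows "\<exists>\<rho>\<^sub>A. \<rho> t = \<rho>\<^sub>A \<otimes>\<^sub>K P \<and> density_matrix \<rho>\<^sub>A"
proof -
  have "trace (block n n (\<rho> t)) = 0" if "n \<noteq> m" for n
    using ptrace_A_diag_const[OF t, of n] that by (simp add: ptrace_A_nth trace_2 \<rho>0 P)
  then show ?thesis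
    using density_matrix_eq_kron_projection[OF P density[OF t]] by blast
qed

lemma projection_1_nth: "((1/2) *\<^sub>R (mat 1 + pauli 3)) $ k $ l = (if k = 1 \<and> l = 1 then 1 else 0)"
  and projection_2_nth: "((1/2) *\<^sub>R (mat 1 - pauli 3)) $ k $ l = (if k = 2 \<and> l = 2 then 1 else 0)"
proof -
  have half: "(1 / 2) *\<^sub>R (2 :: complex) = 1" by (simp add: scaleR_conv_of_real)
  show "((1/2) *\<^sub>R (mat 1 + pauli 3)) $ k $ l = (if k = 1 \<and> l = 1 then 1 else 0)"
    "((1/2) *\<^sub>R (mat 1 - pauli 3)) $ k $ l = (if k = 2 \<and> l = 2 then 1 else 0)"
    using exhaust_2[of k] exhaust_2[of l] by (auto simp: mat_def half)
qed

theorem mainTheorem3: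
  fixes g \<omega>\<^sub>a \<omega>\<^sub>b :: real and H :: "real ^ 3 \<Rightarrow> cmat4"
  assumes "g \<noteq> 0"
    and "H = hamiltonian \<omega>\<^sub>a \<omega>\<^sub>b ((g / 2) *\<^sub>R (pauli 3 \<otimes>\<^sub>K pauli 3))"
  shows
    "(\<forall>(K::nat) (\<l> :: nat \<Rightarrow> cmat2) (\<epsilon>::real) (u :: real \<Rightarrow> real ^ 3) (\<rho> :: real \<Rightarrow> cmat4).
        (\<forall>k<K. trace (\<l> k) = 0) \<longrightarrow>
        \<epsilon> > 0 \<longrightarrow>
        piecewise_smooth \<epsilon> u \<longrightarrow>
        master_solution \<epsilon> H K \<l> u \<rho> \<longrightarrow>
        density_matrix (\<rho> 0) \<longrightarrow>
        (\<forall>t\<in>{0..\<epsilon>}. trace (ptrace_A (\<rho> t) ** ptrace_A (\<rho> t)) = 1) \<longrightarrow>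
        (let a = (\<forall>t\<in>{0..\<epsilon>}. (v_B (\<rho> t) $ 3)\<^sup>2 = 1/4 \<and> v_B (\<rho> t) $ 1 = 0 \<and> v_B (\<rho> t) $ 2 = 0);
             b = (\<forall>t\<in>{0..\<epsilon>}. (v_A (\<rho> t) $ 3)\<^sup>2 = 1/4 \<and> v_A (\<rho> t) $ 1 = 0 \<and> v_A (\<rho> t) $ 2 = 0)
         in (a \<or> b) \<and>
            (a \<longrightarrow>
               (\<forall>t\<in>{0..\<epsilon>}. ptrace_A (\<rho> t) = (1/2) *\<^sub>R (mat 1 + pauli 3)) \<or>
               (\<forall>t\<in>{0..\<epsilon>}. ptrace_A (\<rho> t) = (1/2) *\<^sub>R (mat 1 - pauli 3))) \<and>
            (b \<longrightarrow>
               (\<forall>t\<in>{0..\<epsilon>}.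
                  v_0 K \<l> $ 3 / 2 + v_A (\<rho> t) $ 3 * d_hat K \<l> $ 3 $ 3 = 0 \<and>
                  ((\<lambda>s. v_B (\<rho> s) $ 1) has_vector_derivative
                     - (of_real \<omega>\<^sub>b + 2 * of_real g * v_A (\<rho> t) $ 3) * v_B (\<rho> t) $ 2) (at t within {0..\<epsilon>}) \<and>
                  ((\<lambda>s. v_B (\<rho> s) $ 2) has_vector_derivative
                     (of_real \<omega>\<^sub>b + 2 * of_real g * v_A (\<rho> t) $ 3) * v_B (\<rho> t) $ 1) (at t within {0..\<epsilon>}) \<and>
                  ((\<lambda>s. v_B (\<rho> s) $ 3) has_vector_derivative 0) (at t within {0..\<epsilon>})))))
     \<and>
     (\<forall>P \<in> {(1/2) *\<^sub>R (mat 1 + pauli 3), (1/2) *\<^sub>R (mat 1 - pauli 3)}.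
      \<forall>(K::nat) (\<l> :: nat \<Rightarrow> cmat2) (T::real) (u :: real \<Rightarrow> real ^ 3) (\<rho> :: real \<Rightarrow> cmat4).
        (\<forall>k<K. trace (\<l> k) = 0) \<longrightarrow>
        T > 0 \<longrightarrow>
        piecewise_smooth T u \<longrightarrow>
        master_solution T H K \<l> u \<rho> \<longrightarrow>
        \<rho> 0 \<in> {\<rho>\<^sub>A \<otimes>\<^sub>K P | \<rho>\<^sub>A. density_matrix \<rho>\<^sub>A} \<longrightarrow>
        (\<forall>t\<in>{0..T}. \<rho> t \<in> {\<rho>\<^sub>A \<otimes>\<^sub>K P | \<rho>\<^sub>A. density_matrix \<rho>\<^sub>A}))"
proof (rule conjI, goal_cases)
  case 1
  show ?case
  proof (intro allI impI)
    fix K \<l> \<epsilon> u \<rho>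
    assume "0 < \<epsilon>" and "piecewise_smooth \<epsilon> u" and "master_solution \<epsilon> H K \<l> u \<rho>"
      and "density_matrix (\<rho> 0)"
      and "\<forall>t\<in>{0..\<epsilon>}. trace (ptrace_A (\<rho> t) ** ptrace_A (\<rho> t)) = 1"
    then interpret pure_dispersive_solution g \<omega>\<^sub>a \<omega>\<^sub>b H K \<l> \<epsilon> u \<rho>
      using assms by unfold_locales auto
    show "(let a = (\<forall>t\<in>{0..\<epsilon>}. (v_B (\<rho> t) $ 3)\<^sup>2 = 1/4 \<and> v_B (\<rho> t) $ 1 = 0 \<and> v_B (\<rho> t) $ 2 = 0);
             b = (\<forall>t\<in>{0..\<epsilon>}. (v_A (\<rho> t) $ 3)\<^sup>2 = 1/4 \<and> v_A (\<rho> t) $ 1 = 0 \<and> v_A (\<rho> t) $ 2 = 0)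
         in (a \<or> b) \<and>
            (a \<longrightarrow>
               (\<forall>t\<in>{0..\<epsilon>}. ptrace_A (\<rho> t) = (1/2) *\<^sub>R (mat 1 + pauli 3)) \<or>
               (\<forall>t\<in>{0..\<epsilon>}. ptrace_A (\<rho> t) = (1/2) *\<^sub>R (mat 1 - pauli 3))) \<and>
            (b \<longrightarrow>
               (\<forall>t\<in>{0..\<epsilon>}.
                  v_0 K \<l> $ 3 / 2 + v_A (\<rho> t) $ 3 * d_hat K \<l> $ 3 $ 3 = 0 \<and>
                  ((\<lambda>s. v_B (\<rho> s) $ 1) has_vector_derivative
                     - (of_real \<omega>\<^sub>b + 2 * of_real g * v_A (\<rho> t) $ 3) * v_B (\<rho> t) $ 2) (at t within {0..\<epsilon>}) \<and>
                  ((\<lambda>s. v_B (\<rho> s) $ 2) has_vector_derivative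
                     (of_real \<omega>\<^sub>b + 2 * of_real g * v_A (\<rho> t) $ 3) * v_B (\<rho> t) $ 1) (at t within {0..\<epsilon>}) \<and>
                  ((\<lambda>s. v_B (\<rho> s) $ 3) has_vector_derivative 0) (at t within {0..\<epsilon>}))))"
      unfolding Let_def
      by (intro conjI impI ballI pole_A_or_pole_B pole_B_const pole_A_dissipation_balance v_B_derivative) auto
  qed
next
  case 2
  show ?case
  proof (intro ballI allI impI)
    fix P K \<l> T u \<rho> t
    assume P: "P \<in> {(1/2) *\<^sub>R (mat 1 + pauli 3), (1/2) *\<^sub>R (mat 1 - pauli 3 :: cmat2)}"
      and T: "0 < T" "piecewise_smooth T u" "master_solution T H K \<l> u \<rho>"
      and init: "\<rho> 0 \<in> {\<rho>\<^sub>A \<otimes>\<^sub>K P | \<rho>\<^sub>A. density_matrix \<rho>\<^sub>A}" and t: "t \<in> {0..T}"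
    \<comment> \<open>The plus sign corresponds to \<open>m = 1\<close> and the minus sign to
      \<open>m = 2\<close>, so both sets are treated at once.\<close>
    obtain m :: 2 where m: "\<And>k l. P $ k $ l = (if k = m \<and> l = m then 1 else 0)"
      using P projection_1_nth projection_2_nth by fast
    obtain \<rho>\<^sub>A where \<rho>\<^sub>A: "\<rho> 0 = \<rho>\<^sub>A \<otimes>\<^sub>K P" "density_matrix \<rho>\<^sub>A" using init by blast
    interpret dispersive_solution g \<omega>\<^sub>a \<omega>\<^sub>b H K \<l> T u \<rho>
      using assms T density_matrix_kron_projection[OF m \<rho>\<^sub>A(2)] \<rho>\<^sub>A(1) by unfold_locales auto
    show "\<rho> t \<in> {\<rho>\<^sub>A \<otimes>\<^sub>K P | \<rho>\<^sub>A. density_matrix \<rho>\<^sub>A}"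
      using projection_invariant[OF m \<rho>\<^sub>A(1) t] by blast
  qed
qed

end
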